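(* Assume $\nu_0\ge2$. For every $s\in\mathcal S$ and every $h\ge1$ for which level $h$ of the hierarchy is constructed (i.e. $\nu_{h-1}\ge2$), there exists $\mathcal P_i^h\in\mathscr P_{\rm rec}^{\star,h}:=\mathscr P_1^{\star,h}\cup\cdots\cup\mathscr P_{\nu_h}^{\star,h}$ such that $s\in\mathcal P_i^h$.
   Context: **Setting.** $\Omega$ is a finite set with a connected simple undirected graph structure; $\eta\sim\xi$ means that $\{\eta,\xi\}$ is an edge. $\mathbb H:\Omega\to\mathbb R$ is an energy function. For nonempty $\mathcal A\subseteq\Omega$: $\mathcal F(\mathcal A):=\{\xi\in\mathcal A:\mathbb H(\xi)=\min_{\mathcal A}\mathbb H\}$ (bottom); $\mathbb H(\mathcal A):=\min_{\mathcal A}\mathbb H$ (used for sets on which $\mathbb H$ is constant); $\partial\mathcal A:=\{\eta\in\Omega\setminus\mathcal A:\eta\sim\xi\text{ for some }\xi\in\mathcal A\}$; $\partial^\star\mathcal A:=\mathcal F(\partial\mathcal A)$. $\Phi(\eta,\xi)$ is the minimum, over paths $\eta=\omega_0\sim\omega_1\sim\cdots\sim\omega_N=\xi$, of $\max_n\mathbb H(\omega_n)$; $\Phi(\mathcal A,\mathcal B):=\min_{\eta\in\mathcal A,\xi\in\mathcal B}\Phi(\eta,\xi)$ and $\Phi(\mathcal A,\eta):=\Phi(\mathcal A,\{\eta\})$. $\mathcal S:=\mathcal F(\Omega)$ (ground states), $\overline\Phi:=\max_{s,s'\in\mathcal S}\Phi(s,s')$, $\overline\Omega:=\{\eta\in\Omega:\Phi(\mathcal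 S,\eta)\le\overline\Phi\}$. A set is connected if any two of its points are joined by a path inside it. A *stable plateau* is a nonempty connected set $\mathcal P$ on which $\mathbb H$ is constant and with $\mathbb H(\zeta)>\mathbb H(\mathcal P)$ for all $\zeta\in\partial\mathcal P$. A *cycle* is a nonempty connected set $\mathcal C$ with $\max_{\mathcal C}\mathbb H<\min_{\partial\mathcal C}\mathbb H$; its depth is $\Gamma^{\mathcal C}:=\min_{\partial\mathcal C}\mathbb H-\min_{\mathcal C}\mathbb H$. **Jumps between cycles.** Let $\mathscr C$ be a collection of at least two pairwise disjoint cycles in $\overline\Omega$ and $\Gamma^\star>0$. Put $\mathscr C^\star:=\{\mathcal C\in\mathscr C:\Gamma^{\mathcal C}\ge\Gamma^\star\}$, $\mathscr C^\sharp:=\mathscr C\setminus\mathscr C^\star$, $\Delta:=\overline\Omega\setminus\bigcup_{\mathcal C\in\mathscr C}\mathcal C$. Let $\mathfrak X$ be the continuous-time Markov chain on $\Delta\cup\{\mathcal F(\mathcal C):\mathcal C\in\mathscr C\}$ (each cycle contracted to a single state) with rates: $\mathfrak R(\eta,\xi)=1$ if $\eta,\xi\in\Delta$, $\eta\sim\xi$, $\mathbb H(\xi)\le\mathbb H(\eta)$; $\mathfrak R(\eta,\mathcal F(\mathcal C))=|\{\zeta\in\mathcal C:\eta\sim\zeta\}|$ if $\eta\in\Delta\cap\partial\mathcal C$; $\mathfrak R(\mathcal F(\mathcal C),\eta)=|\mathcal F(\mathcal C)|^{-1}|\{\zeta\in\mathcal C:\eta\sim\zeta\}|$ if $\Gamma^{\mathcal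 C}\le\Gamma^\star$ and $\eta\in\partial^\star\mathcal C$; and $0$ otherwise. Let $\mathfrak X^\star$ be the (trace) Markov chain on $\{\mathcal F(\mathcal C):\mathcal C\in\mathscr C^\star\}$ with rates, for $\mathcal C\ne\mathcal C'$, $\mathfrak R^\star(\mathcal F(\mathcal C),\mathcal F(\mathcal C'))=\sum_{\eta\in\Delta}\mathfrak R(\mathcal F(\mathcal C),\eta)\,\mathbf P_\eta[\text{the first state of }\{\mathcal F(\mathcal C''):\mathcal C''\in\mathscr C^\star\}\text{ hit by }\mathfrak X\text{ is }\mathcal F(\mathcal C')]$, where $\mathbf P_\eta$ is the law of $\mathfrak X$ from $\eta$. **Hierarchy, level 1.** $\mathscr P^1=\mathscr P^{\star,1}=\{\mathcal P_1^1,\dots,\mathcal P_{\nu_0}^1\}$ is the collection of all stable plateaux contained in $\overline\Omega$; standing assumption $\nu_0\ge2$. Put $\Gamma_i^1:=\Phi(\mathcal P_i^1,\bigcup_{j\ne i}\mathcal P_j^1)-\mathbb H(\mathcal P_i^1)$, $\Gamma^{\star,1}:=\min_i\Gamma_i^1$, $\mathcal V_i^1:=\{\eta\in\Omega:\Phi(\mathcal P_i^1,\eta)-\mathbb H(\mathcal P_i^1)<\Gamma_i^1\}$, $\mathscr C^1:=\{\mathcal V_i^1:1\le i\le\nu_0\}$. (The $\mathcal V^1_i$ are disjoint cycles with $\mathcal F(\mathcal V_i^1)=\mathcal P_i^1$.) The construction above applied to $(\mathscr C^1,\Gamma^{\star,1})$ gives $\mathscr C^{\star,1}=\mathscr C^1$,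 $\mathscr C^{\sharp,1}=\emptyset$ and the chain $\mathfrak X^{\star,1}$ on $\mathscr P^{\star,1}$ with rates $\mathfrak R^{\star,1}$. Decompose $\mathscr P^{\star,1}=\mathscr P_1^{\star,1}\cup\dots\cup\mathscr P_{\nu_1}^{\star,1}\cup\mathscr P_{\rm tr}^{\star,1}$ into the irreducible (recurrent) classes of $\mathfrak X^{\star,1}$ and its transient states, and set $\mathscr C_m^{\star,1}:=\{\mathcal V_i^1:\mathcal P_i^1\in\mathscr P_m^{\star,1}\}$ for $m\in\{1,\dots,\nu_1,{\rm tr}\}$. **Level $h\ge2$** (defined as long as $\nu_{h-1}\ge2$). For $i\in\{1,\dots,\nu_{h-1}\}$ put $\mathcal P_i^h:=\bigcup_{\mathcal P\in\mathscr P_i^{\star,h-1}}\mathcal P$, $\mathscr P^{\star,h}:=\{\mathcal P_i^h:1\le i\le\nu_{h-1}\}$, $\Gamma_i^h:=\Phi(\mathcal P_i^h,\bigcup_{j\ne i}\mathcal P_j^h)-\mathbb H(\mathcal P_i^h)$, $\Gamma^{\star,h}:=\min_i\Gamma_i^h$, $\mathcal V_i^h:=\{\eta\in\Omega:\Phi(\mathcal P_i^h,\eta)-\mathbb H(\mathcal P_i^h)<\Gamma_i^h\}$, and $\mathscr C^h:=\{\mathcal V_i^h:1\le i\le\nu_{h-1}\}\cup\{\mathcal C\in\mathscr C_{\rm tr}^{\star,h-1}\cup\mathscr C^{\sharp,h-1}:\mathcal C\cap\mathcal V_i^h=\emptyset\text{ for all }i\}$. (One has $\mathcal F(\mathcal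 V_i^h)=\mathcal P_i^h$.) The construction applied to $(\mathscr C^h,\Gamma^{\star,h})$ gives $\mathscr C^{\star,h}=\{\mathcal V_i^h\}_i$, $\mathscr C^{\sharp,h}=\mathscr C^h\setminus\mathscr C^{\star,h}$ and the chain $\mathfrak X^{\star,h}$ on $\mathscr P^{\star,h}$ with rates $\mathfrak R^{\star,h}$, whose $\nu_h$ irreducible classes $\mathscr P_1^{\star,h},\dots,\mathscr P_{\nu_h}^{\star,h}$ and transient set $\mathscr P_{\rm tr}^{\star,h}$ partition $\mathscr P^{\star,h}$; $\mathscr C_m^{\star,h}:=\{\mathcal V_i^h:\mathcal P_i^h\in\mathscr P_m^{\star,h}\}$. *)

theory Defs
  imports "HOL-Probability.Probability"
begin

section \<open>Continuous-time Markov chains on a finite state space\<close>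

text \<open>
  Rates are functions \<open>R\<close> on pairs of states; only the values \<open>R x y\<close> with \<open>x \<noteq> y\<close> in the
  finite state space \<open>S\<close> matter.
\<close>

definition exit_rate :: "'s set \<Rightarrow> ('s \<Rightarrow> 's \<Rightarrow> real) \<Rightarrow> 's \<Rightarrow> real" where
  "exit_rate S R x = (\<Sum>y\<in>S - {x}. R x y)"

definition jump_pmf :: "'s set \<Rightarrow> ('s \<Rightarrow> 's \<Rightarrow> real) \<Rightarrow> 's \<Rightarrow> 's pmf" where
  "jump_pmf S R x =
     (if exit_rate S R x = 0 then return_pmf x
      else embed_pmf (\<lambda>y. if y \<in> S - {x} then R x y / exit_rate S R x else 0))"

text \<open>
  The chain is built by the jump-chain/holding-time construction.  The \<open>n\<close>-th entry of a sample
  point is an \<open>Exp(1)\<close> variable together with an independent random map \<open>f\<close> on \<open>S\<close>, where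
  \<open>f x\<close> has law \<open>jump_pmf S R x\<close>; the entries are i.i.d.  The \<open>n\<close>-th jump goes from the
  current state \<open>x\<close> to \<open>f x\<close>, after a holding time obtained by dividing the \<open>Exp(1)\<close> variable
  by the exit rate of \<open>x\<close>.  An absorbing state performs fictitious jumps to itself at rate 1.
  The measure is completed, so that events are measurable as soon as they coincide with a
  measurable event up to a null set (such as the event that some holding time vanishes).
\<close>

definition ctmc_measure :: "'s set \<Rightarrow> ('s \<Rightarrow> 's \<Rightarrow> real) \<Rightarrow> (real \<times> ('s \<Rightarrow> 's)) stream measure" where
  "ctmc_measure S R =
     completion (stream_space
       (density lborel (\<lambda>t. ennreal (exponential_density 1 t))
        \<Otimes>\<^sub>M measure_pmf (Pi_pmf S undefined (jump_pmf S R))))"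

primrec jump_chain :: "'s \<Rightarrow> (real \<times> ('s \<Rightarrow> 's)) stream \<Rightarrow> nat \<Rightarrow> 's" where
  "jump_chain x \<omega> 0 = x"
| "jump_chain x \<omega> (Suc n) = snd (\<omega> !! n) (jump_chain x \<omega> n)"

definition holding_time ::
    "'s set \<Rightarrow> ('s \<Rightarrow> 's \<Rightarrow> real) \<Rightarrow> 's \<Rightarrow> (real \<times> ('s \<Rightarrow> 's)) stream \<Rightarrow> nat \<Rightarrow> real" where
  "holding_time S R x \<omega> n =
     (let q = exit_rate S R (jump_chain x \<omega> n)
      in fst (\<omega> !! n) / (if q = 0 then 1 else q))"

definition jump_time ::
    "'s set \<Rightarrow> ('s \<Rightarrow> 's \<Rightarrow> real) \<Rightarrow> 's \<Rightarrow> (real \<times> ('s \<Rightarrow> 's)) stream \<Rightarrow> nat \<Rightarrow> real" where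
  "jump_time S R x \<omega> n = (\<Sum>k<n. holding_time S R x \<omega> k)"

text \<open>
  The state at time \<open>t \<ge> 0\<close> of the chain started from \<open>x\<close>.  It is arbitrary on the null event
  that infinitely many jumps occur before time \<open>t\<close>.
\<close>

definition ctmc_at ::
    "'s set \<Rightarrow> ('s \<Rightarrow> 's \<Rightarrow> real) \<Rightarrow> 's \<Rightarrow> (real \<times> ('s \<Rightarrow> 's)) stream \<Rightarrow> real \<Rightarrow> 's" where
  "ctmc_at S R x \<omega> t = jump_chain x \<omega> (LEAST n. t < jump_time S R x \<omega> (Suc n))"

text \<open>The probability, starting from \<open>x\<close>, that the first state of \<open>A\<close> hit by the chain is \<open>a\<close>.\<close>

definition first_hit_prob ::
    "'s set \<Rightarrow> ('s \<Rightarrow> 's \<Rightarrow> real) \<Rightarrow> 's \<Rightarrow> 's set \<Rightarrow> 's \<Rightarrow> real" where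
  "first_hit_prob S R x A a =
     measure (ctmc_measure S R)
       {\<omega> \<in> space (ctmc_measure S R).
          \<exists>t\<ge>0. ctmc_at S R x \<omega> t = a \<and> a \<in> A \<and> (\<forall>u. 0 \<le> u \<and> u < t \<longrightarrow> ctmc_at S R x \<omega> u \<notin> A)}"

definition leads_to :: "'s set \<Rightarrow> ('s \<Rightarrow> 's \<Rightarrow> real) \<Rightarrow> 's \<Rightarrow> 's \<Rightarrow> bool" where
  "leads_to S R = (\<lambda>x y. x \<in> S \<and> y \<in> S \<and> x \<noteq> y \<and> R x y > 0)\<^sup>*\<^sup>*"

text \<open>
  The irreducible classes are the closed communicating classes: every two states of \<open>A\<close> lead to
  each other, and no state outside \<open>A\<close> can be reached from \<open>A\<close>.  As \<open>S\<close> is finite, these are the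
  recurrent classes, and all the remaining states are transient.
\<close>

definition irreducible_classes :: "'s set \<Rightarrow> ('s \<Rightarrow> 's \<Rightarrow> real) \<Rightarrow> 's set set" where
  "irreducible_classes S R =
     {A. A \<noteq> {} \<and> A \<subseteq> S \<and>
         (\<forall>x\<in>A. \<forall>y\<in>A. leads_to S R x y) \<and>
         (\<forall>x\<in>A. \<forall>y\<in>S - A. \<not> leads_to S R x y)}"


section \<open>Energy landscapes\<close>

text \<open>
  The finite set \<open>\<Omega>\<close> is the universe of the type \<open>'a\<close>, with adjacency relation \<open>E\<close> and energy
  function \<open>H\<close>.
\<close>

context
  fixes E :: "'a :: finite \<Rightarrow> 'a \<Rightarrow> bool" and H :: "'a \<Rightarrow> real"
begin

definition is_path :: "'a \<Rightarrow> 'a \<Rightarrow> 'a list \<Rightarrow> bool" where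
  "is_path \<eta> \<xi> p \<longleftrightarrow> p \<noteq> [] \<and> hd p = \<eta> \<and> last p = \<xi> \<and> successively E p"

definition connected_in_graph :: "'a set \<Rightarrow> bool" where
  "connected_in_graph A \<longleftrightarrow> (\<forall>\<eta>\<in>A. \<forall>\<xi>\<in>A. \<exists>p. is_path \<eta> \<xi> p \<and> set p \<subseteq> A)"

definition energy :: "'a set \<Rightarrow> real" where
  "energy A = Min (H ` A)"

definition bottom :: "'a set \<Rightarrow> 'a set" where
  "bottom A = {\<xi> \<in> A. H \<xi> = energy A}"

definition boundary :: "'a set \<Rightarrow> 'a set" where
  "boundary A = {\<eta>. \<eta> \<notin> A \<and> (\<exists>\<xi>\<in>A. E \<eta> \<xi>)}"

definition boundary_star :: "'a set \<Rightarrow> 'a set" where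
  "boundary_star A = bottom (boundary A)"

definition comm_height :: "'a \<Rightarrow> 'a \<Rightarrow> real" where
  "comm_height \<eta> \<xi> = Min {Max (H ` set p) | p. is_path \<eta> \<xi> p}"

definition comm_height_sets :: "'a set \<Rightarrow> 'a set \<Rightarrow> real" where
  "comm_height_sets A B = Min {comm_height \<eta> \<xi> | \<eta> \<xi>. \<eta> \<in> A \<and> \<xi> \<in> B}"

definition ground_states :: "'a set" where
  "ground_states = bottom UNIV"

definition Phi_bar :: real where
  "Phi_bar = Max {comm_height s s' | s s'. s \<in> ground_states \<and> s' \<in> ground_states}"

definition Omega_bar :: "'a set" where
  "Omega_bar = {\<eta>. comm_height_sets ground_states {\<eta>} \<le> Phi_bar}"

definition stable_plateau :: "'a set \<Rightarrow> bool" where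
  "stable_plateau P \<longleftrightarrow>
     P \<noteq> {} \<and> connected_in_graph P \<and> (\<forall>\<eta>\<in>P. \<forall>\<xi>\<in>P. H \<eta> = H \<xi>) \<and>
     (\<forall>\<zeta>\<in>boundary P. H \<zeta> > energy P)"

definition depth :: "'a set \<Rightarrow> real" where
  "depth C = energy (boundary C) - energy C"

subsection \<open>Jumps between cycles\<close>

text \<open>
  Throughout, \<open>\<C>\<close> is a collection of pairwise disjoint cycles and \<open>\<Gamma>\<close> is the threshold depth.
\<close>

definition deep_cycles :: "'a set set \<Rightarrow> real \<Rightarrow> 'a set set" where
  "deep_cycles \<C> \<Gamma> = {C \<in> \<C>. depth C \<ge> \<Gamma>}"

definition shallow_cycles :: "'a set set \<Rightarrow> real \<Rightarrow> 'a set set" where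
  "shallow_cycles \<C> \<Gamma> = \<C> - deep_cycles \<C> \<Gamma>"

definition Delta :: "'a set set \<Rightarrow> 'a set" where
  "Delta \<C> = Omega_bar - \<Union>\<C>"

text \<open>
  In the contracted chain, \<open>Inl \<eta>\<close> stands for the configuration \<open>\<eta>\<close> and \<open>Inr B\<close> for the single
  state given by the bottom \<open>B\<close> of a cycle.  Disjoint cycles have different bottoms, so the
  cycle can be recovered from \<open>B\<close>.
\<close>

definition cycle_of :: "'a set set \<Rightarrow> 'a set \<Rightarrow> 'a set" where
  "cycle_of \<C> B = (THE C. C \<in> \<C> \<and> bottom C = B)"

definition jump_states :: "'a set set \<Rightarrow> ('a + 'a set) set" where
  "jump_states \<C> = Inl ` Delta \<C> \<union> Inr ` bottom ` \<C>"

fun jump_rate :: "'a set set \<Rightarrow> real \<Rightarrow> 'a + 'a set \<Rightarrow> 'a + 'a set \<Rightarrow> real" where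
  "jump_rate \<C> \<Gamma> (Inl \<eta>) (Inl \<xi>) =
     (if \<eta> \<in> Delta \<C> \<and> \<xi> \<in> Delta \<C> \<and> E \<eta> \<xi> \<and> H \<xi> \<le> H \<eta> then 1 else 0)"
| "jump_rate \<C> \<Gamma> (Inl \<eta>) (Inr B) =
     (let C = cycle_of \<C> B
      in if \<eta> \<in> Delta \<C> \<inter> boundary C then real (card {\<zeta> \<in> C. E \<eta> \<zeta>}) else 0)"
| "jump_rate \<C> \<Gamma> (Inr B) (Inl \<eta>) =
     (let C = cycle_of \<C> B
      in if depth C \<le> \<Gamma> \<and> \<eta> \<in> boundary_star C
         then real (card {\<zeta> \<in> C. E \<eta> \<zeta>}) / real (card (bottom C)) else 0)"
| "jump_rate \<C> \<Gamma> (Inr B) (Inr B') = 0"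

definition trace_states :: "'a set set \<Rightarrow> real \<Rightarrow> 'a set set" where
  "trace_states \<C> \<Gamma> = bottom ` deep_cycles \<C> \<Gamma>"

definition trace_rate :: "'a set set \<Rightarrow> real \<Rightarrow> 'a set \<Rightarrow> 'a set \<Rightarrow> real" where
  "trace_rate \<C> \<Gamma> B B' =
     (\<Sum>\<eta>\<in>Delta \<C>. jump_rate \<C> \<Gamma> (Inr B) (Inl \<eta>) *
        first_hit_prob (jump_states \<C>) (jump_rate \<C> \<Gamma>) (Inl \<eta>)
          (Inr ` trace_states \<C> \<Gamma>) (Inr B'))"

subsection \<open>The hierarchy\<close>

text \<open>
  A family \<open>(P\<^sub>i)\<close> of pairwise disjoint nonempty sets is represented by the set \<open>\<P>\<close> of its members.
\<close>

definition Gam :: "'a set set \<Rightarrow> 'a set \<Rightarrow> real" where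
  "Gam \<P> P = comm_height_sets P (\<Union>(\<P> - {P})) - energy P"

definition Gam_star :: "'a set set \<Rightarrow> real" where
  "Gam_star \<P> = Min (Gam \<P> ` \<P>)"

definition valley :: "'a set set \<Rightarrow> 'a set \<Rightarrow> 'a set" where
  "valley \<P> P = {\<eta>. comm_height_sets P {\<eta>} - energy P < Gam \<P> P}"

definition classes :: "'a set set \<times> 'a set set \<Rightarrow> 'a set set set" where
  "classes L = (case L of (\<P>, \<C>) \<Rightarrow>
     irreducible_classes (trace_states \<C> (Gam_star \<P>)) (trace_rate \<C> (Gam_star \<P>)))"

definition initial_level :: "'a set set \<times> 'a set set" where
  "initial_level =
     (let \<P> = {P. stable_plateau P \<and> P \<subseteq> Omega_bar} in (\<P>, valley \<P> ` \<P>))"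

definition next_level :: "'a set set \<times> 'a set set \<Rightarrow> 'a set set \<times> 'a set set" where
  "next_level L = (case L of (\<P>, \<C>) \<Rightarrow>
     let transient_cycles = valley \<P> ` (\<P> - \<Union>(classes L));
         \<P>' = Union ` classes L
     in (\<P>', valley \<P>' ` \<P>' \<union>
             {C \<in> transient_cycles \<union> shallow_cycles \<C> (Gam_star \<P>).
                \<forall>P\<in>\<P>'. C \<inter> valley \<P>' P = {}}))"

text \<open>
  Level \<open>h \<ge> 1\<close> is the pair of the collection of the \<open>P\<^sub>i\<^sup>h\<close> and the collection of cycles of that
  level; there is no level 0, and the first equation is a dummy.  The recursion is total: its
  value is meaningful as long as \<open>nu k \<ge> 2\<close> for all \<open>k < h\<close>.
\<close>

fun level :: "nat \<Rightarrow> 'a set set \<times> 'a set set" where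
  "level 0 = ({}, {})"
| "level (Suc 0) = initial_level"
| "level (Suc (Suc h)) = next_level (level (Suc h))"

definition nu :: "nat \<Rightarrow> nat" where
  "nu h = (if h = 0 then card (fst (level 1)) else card (classes (level h)))"

text \<open>The recurrent members of the collection of the \<open>P\<^sub>i\<^sup>h\<close>.\<close>

definition P_rec :: "nat \<Rightarrow> 'a set set" where
  "P_rec h = \<Union>(classes (level h))"

end

end

theory Submission
  imports Defs
begin

text \<open>
  The communication height is an ultrametric, and along every jump of the contracted chain the
  energy of the exit level (\<open>H \<eta>\<close> at a configuration, the minimum of \<open>H\<close> on the boundary of a
  cycle) does not increase; a trajectory along which it is constant can be reversed.  If a deep
  cycle with bottom \<open>P\<close> can be left at all, its exit level is \<open>H(P) + \<Gamma>\<close>, while a deep cycle with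
  bottom \<open>Q\<close> has exit level at least \<open>H(Q) + \<Gamma>\<close>.  So jumps of the trace chain do not
  increase the energy of the bottom and are reversible when they preserve it; in particular every
  transient \<open>P\<close> leads to a strictly lower recurrent one.

  For this reason the following property passes from one level of the hierarchy to the next: from
  every configuration outside the plateaux of the level there is a strictly lower plateau that is
  at most as far away, in communication height, as any plateau of at least the same energy.  A
  ground state has nothing below it, so it must lie in a plateau, and in a recurrent one.
\<close>

section \<open>First hitting probabilities\<close>

text \<open>The dynamics enter only through the question which jumps are possible. Recurrence
  depends on the signs of the trace rates, these on the positivity of first hitting probabilities,
  and that on reachability in the contracted chain; every further argument concerns a finite
  directed graph.

  The transported property compares only plateaux of energy at least that of the configuration. This
  restriction lets the witness be replaced when its plateau, of energy e, turns out to be transient: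
  the detour to a recurrent plateau stays within e + \<Gamma>, and a plateau of energy above e is
  separated from all others by at least that height. Lower plateaux satisfy no such bound. The same
  property shows that a valley has its plateau as bottom.

  For the next level to be of the same kind, classes must also be separated strictly above the old
  threshold, which requires that the chain is never trapped away from the plateaux. Strictness makes
  the threshold grow, so cycles that could be left can still be left at the next level.\<close>

definition step_measure :: "'s set \<Rightarrow> ('s \<Rightarrow> 's \<Rightarrow> real) \<Rightarrow> (real \<times> ('s \<Rightarrow> 's)) measure" where
  "step_measure S R = density lborel (\<lambda>t. ennreal (exponential_density 1 t))
     \<Otimes>\<^sub>M measure_pmf (Pi_pmf S undefined (jump_pmf S R))"

definition jump_hit_set :: "'s \<Rightarrow> 's set \<Rightarrow> 's \<Rightarrow> (real \<times> ('s \<Rightarrow> 's)) stream set" where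
  "jump_hit_set x A a = {\<omega>. \<exists>n. jump_chain x \<omega> n = a \<and> a \<in> A \<and> (\<forall>m<n. jump_chain x \<omega> m \<notin> A)}"

text \<open>Only the source has to avoid \<open>A\<close>: such a path may end in \<open>A\<close>,
  but it stops at its first entrance.\<close>

definition step_before :: "'s set \<Rightarrow> ('s \<Rightarrow> 's \<Rightarrow> real) \<Rightarrow> 's set \<Rightarrow> 's \<Rightarrow> 's \<Rightarrow> bool" where
  "step_before S R A x y \<longleftrightarrow> x \<in> S \<and> y \<in> S \<and> x \<noteq> y \<and> R x y > 0 \<and> x \<notin> A"

lemma ctmc_measure_eq: "ctmc_measure S R = completion (stream_space (step_measure S R))"
  by (simp add: ctmc_measure_def step_measure_def)

lemma prob_space_step_measure: "prob_space (step_measure S R)"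
proof -
  interpret e: prob_space "density lborel (\<lambda>t. ennreal (exponential_density 1 t))"
    by (rule prob_space_exponential_density) simp
  interpret p: prob_space "measure_pmf (Pi_pmf S undefined (jump_pmf S R))"
    by (rule prob_space_measure_pmf)
  show ?thesis unfolding step_measure_def
    by (rule prob_space_pair) unfold_locales
qed

lemma space_step_measure [simp]: "space (step_measure S R) = UNIV"
  by (simp add: step_measure_def space_pair_measure)

lemma space_stream_step_measure [simp]: "space (stream_space (step_measure S R)) = UNIV"
  by (simp add: space_stream_space)

lemma AE_step_measure_fst: "AE t in step_measure S R. 0 < fst t"
proof -
  let ?e = "density lborel (\<lambda>t. ennreal (exponential_density 1 t))"
  have "AE t in ?e. (0::real) < t"
  proof (subst AE_density)
    have "AE t in lborel. t \<noteq> (0::real)"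
      by (rule AE_lborel_singleton)
    then show "AE t in lborel. 0 < ennreal (exponential_density 1 t) \<longrightarrow> (0::real) < t"
      by eventually_elim (auto simp: exponential_density_def split: if_splits)
  qed simp
  interpret e: prob_space ?e
    by (rule prob_space_exponential_density) simp
  interpret p: prob_space "measure_pmf (Pi_pmf S undefined (jump_pmf S R))"
    by (rule prob_space_measure_pmf)
  interpret ep: pair_prob_space ?e "measure_pmf (Pi_pmf S undefined (jump_pmf S R))"
    by unfold_locales
  show ?thesis unfolding step_measure_def
  proof (rule ep.AE_pair_measure)
    show "{x \<in> space (?e \<Otimes>\<^sub>M measure_pmf (Pi_pmf S undefined (jump_pmf S R))). 0 < fst x}
        \<in> sets (?e \<Otimes>\<^sub>M measure_pmf (Pi_pmf S undefined (jump_pmf S R)))"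
      by measurable
    show "AE x in ?e. AE y in measure_pmf (Pi_pmf S undefined (jump_pmf S R)). 0 < fst (x, y)"
      using \<open>AE t in ?e. 0 < t\<close> by simp
  qed
qed

lemma measurable_step_apply [measurable]:
  "(\<lambda>t. snd t z) \<in> measurable (step_measure S R) (count_space UNIV)"
  unfolding step_measure_def
  by (rule measurable_compose[OF measurable_snd]) simp

lemma step_measure_apply:
  assumes "finite S" "z \<in> S"
  shows "distr (step_measure S R) (count_space UNIV) (\<lambda>t. snd t z) = measure_pmf (jump_pmf S R z)"
proof -
  let ?e = "density lborel (\<lambda>t. ennreal (exponential_density 1 t))"
  let ?p = "measure_pmf (Pi_pmf S undefined (jump_pmf S R))"
  interpret e: prob_space ?e
    by (rule prob_space_exponential_density) simp
  have "distr (step_measure S R) (count_space UNIV) (\<lambda>t. snd t z)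
      = distr (distr (?e \<Otimes>\<^sub>M ?p) ?p snd) (count_space UNIV) (\<lambda>f. f z)"
    unfolding step_measure_def by (subst distr_distr) (auto simp: comp_def)
  also have "distr (?e \<Otimes>\<^sub>M ?p) ?p snd = ?p"
  proof (rule measure_eqI)
    fix B assume "B \<in> sets (distr (?e \<Otimes>\<^sub>M ?p) ?p snd)"
    have "snd -` B \<inter> space (?e \<Otimes>\<^sub>M ?p) = space ?e \<times> B"
      by (auto simp: space_pair_measure)
    then show "emeasure (distr (?e \<Otimes>\<^sub>M ?p) ?p snd) B = emeasure ?p B"
      using e.emeasure_space_1 by (simp add: emeasure_distr measure_pmf.emeasure_pair_measure_Times)
  qed simp
  also have "distr ?p (count_space UNIV) (\<lambda>f. f z) = measure_pmf (map_pmf (\<lambda>f. f z) (Pi_pmf S undefined (jump_pmf S R)))"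
    by (simp add: map_pmf_rep_eq)
  also have "map_pmf (\<lambda>f. f z) (Pi_pmf S undefined (jump_pmf S R)) = jump_pmf S R z"
    using assms by (simp add: Pi_pmf_component)
  finally show ?thesis .
qed

lemma pmf_jump_pmf:
  assumes "finite S" "\<And>x y. 0 \<le> R x y" "exit_rate S R x \<noteq> 0"
  shows "pmf (jump_pmf S R x) y = (if y \<in> S - {x} then R x y / exit_rate S R x else 0)"
proof -
  have pos: "exit_rate S R x \<ge> 0"
    unfolding exit_rate_def by (intro sum_nonneg assms)
  have "(\<integral>\<^sup>+ y. ennreal (if y \<in> S - {x} then R x y / exit_rate S R x else 0) \<partial>count_space UNIV)
     = (\<integral>\<^sup>+ y. ennreal (R x y / exit_rate S R x) * indicator (S - {x}) y \<partial>count_space UNIV)"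
    by (intro nn_integral_cong) (auto simp: indicator_def)
  also have "\<dots> = (\<Sum>y\<in>S - {x}. ennreal (R x y / exit_rate S R x))"
    using assms(1) by (simp add: nn_integral_count_space_indicator[symmetric] nn_integral_count_space_finite)
  also have "\<dots> = ennreal (\<Sum>y\<in>S - {x}. R x y / exit_rate S R x)"
    using assms pos by (intro sum_ennreal) auto
  also have "(\<Sum>y\<in>S - {x}. R x y / exit_rate S R x) = 1"
    using assms(3) by (simp add: sum_divide_distrib[symmetric] exit_rate_def)
  finally have "(\<integral>\<^sup>+ y. ennreal (if y \<in> S - {x} then R x y / exit_rate S R x else 0) \<partial>count_space UNIV) = 1"
    by simp
  then show ?thesis
    using assms pos by (simp add: jump_pmf_def pmf_embed_pmf)
qed

text \<open>The alternative \<open>y = x\<close> covers the fictitious self-jump of an absorbing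
  state.\<close>

lemma set_jump_pmf:
  assumes "finite S" "\<And>x y. 0 \<le> R x y"
  shows "y \<in> set_pmf (jump_pmf S R x) \<Longrightarrow> y = x \<or> y \<in> S \<and> R x y > 0"
    and "y \<in> S \<Longrightarrow> x \<noteq> y \<Longrightarrow> R x y > 0 \<Longrightarrow> y \<in> set_pmf (jump_pmf S R x)"
proof -
  have pos: "exit_rate S R x \<ge> 0"
    unfolding exit_rate_def by (intro sum_nonneg assms)
  show "y \<in> set_pmf (jump_pmf S R x) \<Longrightarrow> y = x \<or> y \<in> S \<and> R x y > 0"
  proof (cases "exit_rate S R x = 0")
    case False
    then show "y \<in> set_pmf (jump_pmf S R x) \<Longrightarrow> y = x \<or> y \<in> S \<and> R x y > 0"
      using pos assms(2)[of x y]
      by (auto simp: set_pmf_iff pmf_jump_pmf[OF assms] split: if_splits)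
  qed (simp add: jump_pmf_def)
  assume y: "y \<in> S" "x \<noteq> y" "R x y > 0"
  have "R x y \<le> exit_rate S R x"
    unfolding exit_rate_def using y assms by (intro member_le_sum) auto
  with y have "exit_rate S R x \<noteq> 0" by simp
  with y show "y \<in> set_pmf (jump_pmf S R x)"
    by (auto simp: set_pmf_iff pmf_jump_pmf[OF assms])
qed

lemma jump_chain_SCons: "jump_chain x (t ## \<omega>) (Suc n) = jump_chain (snd t x) \<omega> n"
  by (induction n) auto

lemma measurable_jump_chain [measurable]:
  fixes x :: "'s :: countable"
  shows "(\<lambda>\<omega>. jump_chain x \<omega> n) \<in> measurable (stream_space (step_measure S R)) (count_space UNIV)"
proof (induction n)
  case (Suc n)
  have "(\<lambda>\<omega>. snd (\<omega> !! n) z) \<in> measurable (stream_space (step_measure S R)) (count_space UNIV)" for z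
    by measurable
  \<comment> \<open>The map is evaluated at a random state; countability of the state type reduces
    this to the fixed states \<open>z\<close>.\<close>
  from measurable_compose_countable[OF this Suc] show ?case by simp
qed simp

lemma sets_jump_hit_set [measurable]:
  fixes x :: "'s :: countable"
  shows "jump_hit_set x A a \<in> sets (stream_space (step_measure S R))"
proof -
  have "{\<omega> \<in> space (stream_space (step_measure S R)).
      \<exists>n. jump_chain x \<omega> n = a \<and> a \<in> A \<and> (\<forall>m<n. jump_chain x \<omega> m \<notin> A)}
    \<in> sets (stream_space (step_measure S R))"
    by measurable
  then show ?thesis by (simp add: jump_hit_set_def)
qed

text \<open>First-step analysis: from \<open>x\<close> outside \<open>A\<close> the hitting index
  cannot be 0, so shifting the stream loses nothing.\<close>

lemma jump_hit_set_SCons: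
  assumes "x \<notin> A"
  shows "t ## \<omega> \<in> jump_hit_set x A a \<longleftrightarrow> \<omega> \<in> jump_hit_set (snd t x) A a"
proof
  assume "t ## \<omega> \<in> jump_hit_set x A a"
  then obtain n where n: "jump_chain x (t ## \<omega>) n = a" "a \<in> A"
      "\<forall>m<n. jump_chain x (t ## \<omega>) m \<notin> A"
    by (auto simp: jump_hit_set_def)
  from n(1,2) assms obtain k where k: "n = Suc k" by (cases n) auto
  have "jump_chain (snd t x) \<omega> m \<notin> A" if "m < k" for m
    using n(3)[rule_format, of "Suc m"] that k by (simp add: jump_chain_SCons del: jump_chain.simps)
  with n(1,2) k show "\<omega> \<in> jump_hit_set (snd t x) A a"
    by (auto simp: jump_hit_set_def jump_chain_SCons simp del: jump_chain.simps)
next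
  assume "\<omega> \<in> jump_hit_set (snd t x) A a"
  then obtain n where n: "jump_chain (snd t x) \<omega> n = a" "a \<in> A"
      "\<forall>m<n. jump_chain (snd t x) \<omega> m \<notin> A"
    by (auto simp: jump_hit_set_def)
  have "jump_chain x (t ## \<omega>) m \<notin> A" if "m < Suc n" for m
    using that n(3) assms by (cases m) (auto simp: jump_chain_SCons simp del: jump_chain.simps(2))
  with n(1,2) show "t ## \<omega> \<in> jump_hit_set x A a"
    unfolding jump_hit_set_def
    by (auto simp: jump_chain_SCons simp del: jump_chain.simps intro!: exI[of _ "Suc n"])
qed

text \<open>The entries of the stream are independent: with positive probability the first map
  follows the first edge of the path, and the tail does the rest. The induction therefore prepends
  edges.\<close>

lemma jump_hit_set_pos:
  fixes x :: "'s :: countable"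
  assumes "finite S" "\<And>x y. 0 \<le> R x y" "a \<in> A"
    and "(step_before S R A)\<^sup>*\<^sup>* x a"
  shows "0 < emeasure (stream_space (step_measure S R)) (jump_hit_set x A a)"
  using assms(4)
proof (induction rule: converse_rtranclp_induct)
  case base
  interpret prob_space "step_measure S R" by (rule prob_space_step_measure)
  interpret s: prob_space "stream_space (step_measure S R)" by (rule prob_space_stream_space)
  have "jump_hit_set a A a = space (stream_space (step_measure S R))"
    using assms(3) by (auto simp: jump_hit_set_def intro!: exI[of _ 0])
  then show ?case using s.emeasure_space_1 by simp
next
  case (step x y)
  let ?N = "stream_space (step_measure S R)"
  interpret prob_space "step_measure S R" by (rule prob_space_step_measure)
  from step(1) have xy: "x \<in> S" "y \<in> S" "x \<noteq> y" "R x y > 0" "x \<notin> A"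
    by (auto simp: step_before_def)
  have set: "{t. snd t x = y} \<in> sets (step_measure S R)"
    using measurable_sets[OF measurable_step_apply[of x S R], of "{y}"]
    by (simp add: vimage_def)
  have "emeasure (step_measure S R) {t. snd t x = y}
      = emeasure (distr (step_measure S R) (count_space UNIV) (\<lambda>t. snd t x)) {y}"
    by (subst emeasure_distr) (auto simp: vimage_def)
  also have "\<dots> = ennreal (pmf (jump_pmf S R x) y)"
    using assms(1) xy(1) by (simp add: step_measure_apply emeasure_pmf_single)
  also have "\<dots> > 0"
    using set_jump_pmf(2)[of S R y x] assms xy by (simp add: pmf_positive)
  finally have pos: "emeasure (step_measure S R) {t. snd t x = y} > 0" .
  have "0 < emeasure ?N (jump_hit_set y A a) * emeasure (step_measure S R) {t. snd t x = y}"
    using step.IH pos by (simp add: ennreal_zero_less_mult_iff)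
  also have "\<dots> = (\<integral>\<^sup>+t. emeasure ?N (jump_hit_set y A a) * indicator {t. snd t x = y} t \<partial>step_measure S R)"
    using set by (simp add: nn_integral_cmult_indicator)
  \<comment> \<open>Where the first map sends \<open>x\<close> to \<open>y\<close>, the section at
    the first entry is the hitting event from \<open>y\<close>; elsewhere the left integrand is
    0.\<close>
  also have "\<dots> \<le> (\<integral>\<^sup>+t. emeasure ?N {\<omega> \<in> space ?N. t ## \<omega> \<in> jump_hit_set x A a} \<partial>step_measure S R)"
    using xy(5) by (intro nn_integral_mono) (auto simp: indicator_def jump_hit_set_SCons)
  also have "\<dots> = emeasure ?N (jump_hit_set x A a)"
    by (rule emeasure_stream_space[symmetric]) (rule sets_jump_hit_set)
  finally show ?case .
qed

section \<open>Jump index and continuous time\<close>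

lemma ctmc_at_eq:
  assumes pos: "\<And>n. 0 < holding_time S R x \<omega> n"
    and t: "jump_time S R x \<omega> n \<le> t" "t < jump_time S R x \<omega> (Suc n)"
  shows "ctmc_at S R x \<omega> t = jump_chain x \<omega> n"
proof -
  have mono: "mono (jump_time S R x \<omega>)"
    unfolding mono_iff_le_Suc using pos by (auto simp: jump_time_def less_imp_le)
  have "(LEAST n. t < jump_time S R x \<omega> (Suc n)) = n"
  proof (rule Least_equality)
    fix m assume "t < jump_time S R x \<omega> (Suc m)"
    with t(1) have "\<not> Suc m \<le> n"
      using monoD[OF mono, of "Suc m" n] by auto
    then show "n \<le> m" by simp
  qed (rule t(2))
  then show ?thesis by (simp add: ctmc_at_def)
qed

text \<open>
  Explosion is harmless here: after the explosion time \<^const>\<open>ctmc_at\<close> takes the value of the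
  jump chain at some fixed index, so it cannot produce a new first entrance into \<open>A\<close>.
\<close>

lemma first_hit_iff_jump_hit:
  assumes pos: "\<And>n. 0 < holding_time S R x \<omega> n"
  shows "(\<exists>t\<ge>0. ctmc_at S R x \<omega> t = a \<and> a \<in> A \<and> (\<forall>u. 0 \<le> u \<and> u < t \<longrightarrow> ctmc_at S R x \<omega> u \<notin> A))
    \<longleftrightarrow> \<omega> \<in> jump_hit_set x A a" (is "?L \<longleftrightarrow> ?R")
proof -
  let ?J = "jump_time S R x \<omega>"
  have J0: "?J 0 = 0" by (simp add: jump_time_def)
  have step: "?J n < ?J (Suc n)" for n using pos by (simp add: jump_time_def)
  have mono: "mono ?J" unfolding mono_iff_le_Suc using step by (auto simp: less_imp_le)
  have nn: "0 \<le> ?J n" for n using monoD[OF mono, of 0 n] J0 by simp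
  have find: "\<exists>m<n. ?J m \<le> u \<and> u < ?J (Suc m)" if "0 \<le> u" "u < ?J n" for u n
    using that
  proof (induction n)
    case 0
    then show ?case using J0 by simp
  next
    case (Suc n)
    show ?case
    proof (cases "u < ?J n")
      case True
      then show ?thesis using Suc less_Suc_eq by blast
    qed (use Suc in auto)
  qed
  show ?thesis
  proof
    assume ?L
    then obtain t where t: "t \<ge> 0" "ctmc_at S R x \<omega> t = a" "a \<in> A"
      "\<And>u. 0 \<le> u \<Longrightarrow> u < t \<Longrightarrow> ctmc_at S R x \<omega> u \<notin> A" by blast
    define n where "n = (LEAST n. t < ?J (Suc n))"
    have a: "jump_chain x \<omega> n = a" using t(2) by (simp add: ctmc_at_def n_def)
    \<comment> \<open>This holds even if the \<open>LEAST\<close> predicate has no solution: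
      \<open>t < ?J n\<close> would produce a solution below \<open>n\<close>.\<close>
    have le: "?J n \<le> t"
    proof (rule ccontr)
      assume "\<not> ?J n \<le> t"
      then obtain m where m: "m < n" "t < ?J (Suc m)" using find[OF t(1), of n] by auto
      then show False unfolding n_def using not_less_Least by blast
    qed
    have "jump_chain x \<omega> m \<notin> A" if "m < n" for m
    proof -
      have "?J m < ?J (Suc m)" by (rule step)
      also have "?J (Suc m) \<le> ?J n" using monoD[OF mono, of "Suc m" n] that by simp
      finally have "?J m < t" using le by simp
      then have "ctmc_at S R x \<omega> (?J m) \<notin> A" using t(4) nn by blast
      then show ?thesis using ctmc_at_eq[OF pos order_refl step] by simp
    qed
    with a t(3) show ?R by (auto simp: jump_hit_set_def)
  next
    assume ?R
    then obtain n where n: "jump_chain x \<omega> n = a" "a \<in> A" "\<And>m. m < n \<Longrightarrow> jump_chain x \<omega> m \<notin> A"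
      by (auto simp: jump_hit_set_def)
    have "ctmc_at S R x \<omega> (?J n) = a" using ctmc_at_eq[OF pos order_refl step] n by simp
    moreover have "ctmc_at S R x \<omega> u \<notin> A" if "0 \<le> u" "u < ?J n" for u
      using find[OF that] ctmc_at_eq[OF pos] n(3) by metis
    ultimately show ?L using nn n(2) by blast
  qed
qed

lemma holding_time_pos:
  assumes "\<And>x y. 0 \<le> R x y" "0 < fst (\<omega> !! n)"
  shows "0 < holding_time S R x \<omega> n"
proof -
  have "exit_rate S R y \<ge> 0" for y
    unfolding exit_rate_def by (intro sum_nonneg assms)
  from this[of "jump_chain x \<omega> n"] show ?thesis
    using assms(2) by (simp add: holding_time_def Let_def)
qed

lemma AE_stream_step_fst: "AE \<omega> in stream_space (step_measure S R). \<forall>n. 0 < fst (\<omega> !! n)"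
proof -
  interpret prob_space "step_measure S R" by (rule prob_space_step_measure)
  have "Measurable.pred (step_measure S R) (\<lambda>t. 0 < fst t)"
    unfolding step_measure_def by measurable
  from AE_stream_all[OF this AE_step_measure_fst] show ?thesis
    by eventually_elim (auto simp: stream_all_def)
qed

lemma AE_stream_step_snd:
  assumes "finite S"
  shows "AE \<omega> in stream_space (step_measure S R).
    \<forall>n. \<forall>z\<in>S. snd (\<omega> !! n) z \<in> set_pmf (jump_pmf S R z)"
proof -
  interpret prob_space "step_measure S R" by (rule prob_space_step_measure)
  have m: "Measurable.pred (step_measure S R) (\<lambda>t. snd t z \<in> set_pmf (jump_pmf S R z))" for z
    by (rule measurable_compose[OF measurable_step_apply]) simp
  have "AE t in step_measure S R. snd t z \<in> set_pmf (jump_pmf S R z)" if "z \<in> S" for z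
  proof -
    have "AE w in distr (step_measure S R) (count_space UNIV) (\<lambda>t. snd t z). w \<in> set_pmf (jump_pmf S R z)"
      unfolding step_measure_apply[OF assms that] by (simp add: AE_measure_pmf)
    then show ?thesis by (subst (asm) AE_distr_iff) auto
  qed
  then have "AE t in step_measure S R. \<forall>z\<in>S. snd t z \<in> set_pmf (jump_pmf S R z)"
    using assms by (intro AE_finite_allI) auto
  moreover have "Measurable.pred (step_measure S R) (\<lambda>t. \<forall>z\<in>S. snd t z \<in> set_pmf (jump_pmf S R z))"
    using assms m by (intro pred_intros_finite) auto
  ultimately have "AE \<omega> in stream_space (step_measure S R).
      stream_all (\<lambda>t. \<forall>z\<in>S. snd t z \<in> set_pmf (jump_pmf S R z)) \<omega>"
    by (intro AE_stream_all)
  then show ?thesis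
    by eventually_elim (auto simp: stream_all_def)
qed

text \<open>Measurability of the continuous-time event comes from the completion: off the null set
  \<open>Z\<close>, where some holding time may vanish, the event agrees with the measurable
  jump-chain event, and its part inside \<open>Z\<close> is a null set.\<close>

lemma first_hit_prob_eq:
  fixes x :: "'s :: countable"
  assumes "\<And>x y. 0 \<le> R x y"
  shows "first_hit_prob S R x A a = measure (stream_space (step_measure S R)) (jump_hit_set x A a)"
proof -
  let ?N = "stream_space (step_measure S R)"
  let ?F = "{\<omega> \<in> space (ctmc_measure S R).
          \<exists>t\<ge>0. ctmc_at S R x \<omega> t = a \<and> a \<in> A \<and> (\<forall>u. 0 \<le> u \<and> u < t \<longrightarrow> ctmc_at S R x \<omega> u \<notin> A)}"
  obtain Z where Z: "Z \<in> null_sets ?N" "{\<omega> \<in> space ?N. \<not> (\<forall>n. 0 < fst (\<omega> !! n))} \<subseteq> Z"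
    using AE_stream_step_fst[of S R] unfolding eventually_ae_filter by auto
  have iff: "\<omega> \<in> ?F \<longleftrightarrow> \<omega> \<in> jump_hit_set x A a" if "\<omega> \<notin> Z" for \<omega>
  proof -
    have "0 < holding_time S R x \<omega> n" for n
      using Z(2) that assms by (intro holding_time_pos) auto
    then show ?thesis
      using first_hit_iff_jump_hit[of S R x \<omega> a A] by (simp add: ctmc_measure_eq)
  qed
  have Zc: "Z \<in> null_sets (completion ?N)"
    using Z(1) by (rule null_sets_completionI)
  then have ZF: "Z \<inter> ?F \<in> null_sets (completion ?N)"
    by (rule null_sets_completion_subset[rotated]) blast
  have eq: "?F = (jump_hit_set x A a - Z) \<union> (Z \<inter> ?F)"
    using iff by blast
  have sets: "jump_hit_set x A a - Z \<in> sets (completion ?N)" "jump_hit_set x A a \<in> sets (completion ?N)"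
    using Z(1) by (auto intro!: sets_completionI_sets sets.Diff sets_jump_hit_set)
  have "measure (completion ?N) ?F = measure (completion ?N) (jump_hit_set x A a - Z)"
    by (subst eq, rule measure_Un_null_set) (use sets Zc ZF in auto)
  also have "\<dots> = measure (completion ?N) (jump_hit_set x A a)"
    by (rule measure_Diff_null_set) (use sets Zc ZF in auto)
  also have "\<dots> = measure ?N (jump_hit_set x A a)"
    by (rule measure_completion) (rule sets_jump_hit_set)
  finally show ?thesis
    by (simp add: first_hit_prob_def ctmc_measure_eq)
qed

text \<open>From left to right: almost every sample jumps only along positive rates, so an event of
  positive probability contains such a sample. Its trajectory up to the hit, with self-jumps
  dropped, is the required path.\<close>

lemma first_hit_prob_pos_iff:
  fixes x :: "'s :: countable"
  assumes fin: "finite S" and nonneg: "\<And>x y. 0 \<le> R x y" and x: "x \<in> S" and a: "a \<in> A"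
  shows "0 < first_hit_prob S R x A a \<longleftrightarrow> (step_before S R A)\<^sup>*\<^sup>* x a"
proof
  let ?N = "stream_space (step_measure S R)"
  interpret p: prob_space "step_measure S R" by (rule prob_space_step_measure)
  interpret prob_space ?N by (rule p.prob_space_stream_space)
  {
    assume "0 < first_hit_prob S R x A a"
    then have pos: "0 < measure ?N (jump_hit_set x A a)"
      by (simp add: first_hit_prob_eq nonneg)
    have "\<exists>\<omega>\<in>jump_hit_set x A a. \<forall>n. \<forall>z\<in>S. snd (\<omega> !! n) z \<in> set_pmf (jump_pmf S R z)"
    proof (rule ccontr)
      assume neg: "\<not> ?thesis"
      have "AE \<omega> in ?N. \<omega> \<notin> jump_hit_set x A a"
        using AE_stream_step_snd[OF fin] by eventually_elim (use neg in blast)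
      then have "measure ?N (jump_hit_set x A a) = 0"
        by (subst prob_eq_0) auto
      with pos show False by simp
    qed
    then obtain \<omega> n where \<omega>: "\<And>n z. z \<in> S \<Longrightarrow> snd (\<omega> !! n) z \<in> set_pmf (jump_pmf S R z)"
      and n: "jump_chain x \<omega> n = a" "\<And>m. m < n \<Longrightarrow> jump_chain x \<omega> m \<notin> A"
      by (auto simp: jump_hit_set_def)
    have "jump_chain x \<omega> m \<in> S \<and> (step_before S R A)\<^sup>*\<^sup>* x (jump_chain x \<omega> m)" if "m \<le> n" for m
      using that
    proof (induction m)
      case 0
      then show ?case using x by simp
    next
      case (Suc m)
      let ?y = "jump_chain x \<omega> m" and ?z = "jump_chain x \<omega> (Suc m)"
      from Suc have IH: "?y \<in> S" "(step_before S R A)\<^sup>*\<^sup>* x ?y" by auto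
      have "?z \<in> set_pmf (jump_pmf S R ?y)" using \<omega>[OF IH(1)] by simp
      from set_jump_pmf(1)[OF fin nonneg this] have "?z = ?y \<or> ?z \<in> S \<and> R ?y ?z > 0" .
      moreover have "?y \<notin> A" using n(2) Suc.prems by simp
      ultimately have "?z = ?y \<or> step_before S R A ?y ?z"
        using IH(1) unfolding step_before_def by metis
      then show ?case
      proof
        assume "?z = ?y" then show ?thesis using IH by simp
      next
        assume s: "step_before S R A ?y ?z"
        then have "?z \<in> S" by (simp add: step_before_def del: jump_chain.simps)
        then show ?thesis using rtranclp.rtrancl_into_rtrancl[OF IH(2) s] by simp
      qed
    qed
    then show "(step_before S R A)\<^sup>*\<^sup>* x a" using n(1) by blast
  next
    assume "(step_before S R A)\<^sup>*\<^sup>* x a"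
    from jump_hit_set_pos[OF fin nonneg a this]
    show "0 < first_hit_prob S R x A a"
      by (simp add: first_hit_prob_eq nonneg emeasure_eq_measure)
  }
qed

section \<open>Communication heights, cycles and valleys\<close>

lemma rtranclp_crossing:
  assumes "R\<^sup>*\<^sup>* x y" "x \<in> W" "y \<notin> W"
  obtains u v where "R u v" "u \<in> W" "v \<notin> W"
  using assms by (induction rule: rtranclp_induct) auto

text \<open>The reflexive closure also relates points outside \<open>A\<close> to themselves, hence
  the separate \<open>x \<in> A\<close>.\<close>

lemma ex_path_iff_rtranclp:
  "(\<exists>p. is_path E x y p \<and> set p \<subseteq> A) \<longleftrightarrow> x \<in> A \<and> (\<lambda>u v. E u v \<and> u \<in> A \<and> v \<in> A)\<^sup>*\<^sup>* x y"
proof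
  assume "\<exists>p. is_path E x y p \<and> set p \<subseteq> A"
  then obtain p where "is_path E x y p" "set p \<subseteq> A" by blast
  then show "x \<in> A \<and> (\<lambda>u v. E u v \<and> u \<in> A \<and> v \<in> A)\<^sup>*\<^sup>* x y"
  proof (induction p arbitrary: x)
    case (Cons u p)
    show ?case
    proof (cases p)
      case (Cons v q)
      with Cons.prems have "is_path E v y p" "E u v" "u = x"
        by (auto simp: is_path_def)
      with Cons.IH[of v] Cons.prems show ?thesis
        by (auto intro: converse_rtranclp_into_rtranclp)
    qed (use Cons.prems in \<open>auto simp: is_path_def\<close>)
  qed (simp add: is_path_def)
next
  assume "x \<in> A \<and> (\<lambda>u v. E u v \<and> u \<in> A \<and> v \<in> A)\<^sup>*\<^sup>* x y"
  then have "(\<lambda>u v. E u v \<and> u \<in> A \<and> v \<in> A)\<^sup>*\<^sup>* x y" "x \<in> A" by auto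
  then show "\<exists>p. is_path E x y p \<and> set p \<subseteq> A"
  proof (induction rule: converse_rtranclp_induct)
    case base
    then show ?case by (intro exI[of _ "[y]"]) (simp add: is_path_def)
  next
    case (step u v)
    then obtain p where p: "is_path E v y p" "set p \<subseteq> A" by auto
    with step(1) have "is_path E u y (u # p)" by (auto simp: is_path_def successively_Cons)
    with p step(1) show ?case by (intro exI[of _ "u # p"]) auto
  qed
qed

locale landscape =
  fixes E :: "'a :: finite \<Rightarrow> 'a \<Rightarrow> bool" and H :: "'a \<Rightarrow> real"
  assumes sym: "symp E" and irrefl: "irreflp E" and connected: "connected_in_graph E UNIV"
begin

abbreviation \<Phi> where "\<Phi> \<equiv> comm_height E H"
abbreviation \<Phi>s where "\<Phi>s \<equiv> comm_height_sets E H"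
abbreviation Obar where "Obar \<equiv> Omega_bar E H"
abbreviation \<Phi>bar where "\<Phi>bar \<equiv> Phi_bar E H"
abbreviation bd where "bd \<equiv> boundary E"
abbreviation en where "en \<equiv> energy H"

lemma E_sym: "E x y \<Longrightarrow> E y x" using sym by (rule sympD)

lemma E_irrefl: "\<not> E x x" using irrefl by (simp add: irreflp_def)

lemma comm_height_le_iff_path: "\<Phi> x y \<le> c \<longleftrightarrow> (\<exists>p. is_path E x y p \<and> set p \<subseteq> {z. H z \<le> c})"
proof -
  let ?M = "{Max (H ` set p) | p. is_path E x y p}"
  \<comment> \<open>There may be infinitely many paths, but the maximum depends only on the set of
    visited points.\<close>
  have "?M \<subseteq> (\<lambda>X. Max (H ` X)) ` UNIV" by auto
  then have fin: "finite ?M" by (rule finite_subset) simp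
  obtain p0 where "is_path E x y p0" using connected by (auto simp: connected_in_graph_def)
  then have ne: "?M \<noteq> {}" by auto
  have "\<Phi> x y \<le> c \<longleftrightarrow> (\<exists>m\<in>?M. m \<le> c)"
    unfolding comm_height_def by (rule Min_le_iff[OF fin ne])
  also have "\<dots> \<longleftrightarrow> (\<exists>p. is_path E x y p \<and> set p \<subseteq> {z. H z \<le> c})"
  proof -
    have "Max (H ` set p) \<le> c \<longleftrightarrow> set p \<subseteq> {z. H z \<le> c}" if "is_path E x y p" for p
      using that by (auto simp: is_path_def)
    then show ?thesis by blast
  qed
  finally show ?thesis .
qed

text \<open>In this form the ultrametric inequality is just transitivity of reachability below a
  level.\<close>

lemma comm_height_le_iff:
  "\<Phi> x y \<le> c \<longleftrightarrow> H x \<le> c \<and> (\<lambda>u v. E u v \<and> H u \<le> c \<and> H v \<le> c)\<^sup>*\<^sup>* x y"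
  unfolding comm_height_le_iff_path ex_path_iff_rtranclp by simp

text \<open>The usual source of lower bounds on \<Phi>: an optimal path must leave \<open>W\<close>
  along some edge.\<close>

lemma comm_height_crossing:
  assumes "x \<in> W" "y \<notin> W"
  obtains u v where "E u v" "u \<in> W" "v \<notin> W" "H u \<le> \<Phi> x y" "H v \<le> \<Phi> x y"
proof -
  have "(\<lambda>u v. E u v \<and> H u \<le> \<Phi> x y \<and> H v \<le> \<Phi> x y)\<^sup>*\<^sup>* x y"
    using comm_height_le_iff[of x y "\<Phi> x y"] by simp
  from rtranclp_crossing[OF this assms] that show ?thesis by blast
qed

lemma comm_height_ge_left: "H x \<le> \<Phi> x y"
  using comm_height_le_iff[of x y "\<Phi> x y"] by simp

lemma comm_height_refl [simp]: "\<Phi> x x = H x"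
  by (rule antisym) (simp_all add: comm_height_le_iff comm_height_ge_left)

lemma comm_height_sym: "\<Phi> x y = \<Phi> y x"
proof -
  have "\<Phi> y x \<le> \<Phi> x y" for x y
  proof -
    have *: "(\<lambda>u v. E u v \<and> H u \<le> \<Phi> x y \<and> H v \<le> \<Phi> x y)\<^sup>*\<^sup>* x y"
      using comm_height_le_iff[of x y "\<Phi> x y"] by simp
    have "symp (\<lambda>u v. E u v \<and> H u \<le> \<Phi> x y \<and> H v \<le> \<Phi> x y)"
      using E_sym by (auto simp: symp_def)
    then have "(\<lambda>u v. E u v \<and> H u \<le> \<Phi> x y \<and> H v \<le> \<Phi> x y)\<^sup>*\<^sup>* y x"
      using * by (rule sympD[OF symp_rtranclp])
    moreover have "H y \<le> \<Phi> x y"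
      using * comm_height_ge_left[of x y] by (cases rule: rtranclp.cases) auto
    ultimately show ?thesis by (simp add: comm_height_le_iff)
  qed
  then show ?thesis by (simp add: antisym)
qed

lemma comm_height_ge_right: "H y \<le> \<Phi> x y"
  using comm_height_ge_left[of y x] by (simp add: comm_height_sym)

lemma comm_height_trans: "\<Phi> x y \<le> c \<Longrightarrow> \<Phi> y z \<le> c \<Longrightarrow> \<Phi> x z \<le> c"
  by (auto simp: comm_height_le_iff)

lemma comm_height_trans_less: "\<Phi> x y < c \<Longrightarrow> \<Phi> y z < c \<Longrightarrow> \<Phi> x z < c"
  using comm_height_trans[of x y "max (\<Phi> x y) (\<Phi> y z)" z] by auto

lemma comm_height_edge: "E x y \<Longrightarrow> H x \<le> c \<Longrightarrow> H y \<le> c \<Longrightarrow> \<Phi> x y \<le> c"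
  by (auto simp: comm_height_le_iff)

lemma
  assumes "A \<noteq> {}" "B \<noteq> {}"
  shows comm_height_sets_le: "\<lbrakk>a \<in> A; b \<in> B\<rbrakk> \<Longrightarrow> \<Phi>s A B \<le> \<Phi> a b"
    and comm_height_sets_attained: "\<exists>a\<in>A. \<exists>b\<in>B. \<Phi>s A B = \<Phi> a b"
proof -
  let ?M = "{\<Phi> \<eta> \<xi> | \<eta> \<xi>. \<eta> \<in> A \<and> \<xi> \<in> B}"
  have M: "?M = (\<lambda>(a, b). \<Phi> a b) ` (A \<times> B)" by auto
  have fin: "finite ?M" unfolding M by simp
  show "\<Phi>s A B \<le> \<Phi> a b" if "a \<in> A" "b \<in> B"
    unfolding comm_height_sets_def using that by (intro Min_le fin) auto
  have "Min ?M \<in> ?M" using assms by (intro Min_in fin) auto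
  then show "\<exists>a\<in>A. \<exists>b\<in>B. \<Phi>s A B = \<Phi> a b"
    unfolding comm_height_sets_def by auto
qed

lemma energy_le: "x \<in> A \<Longrightarrow> en A \<le> H x"
  unfolding energy_def by (intro Min_le) auto

lemma energy_attained: "A \<noteq> {} \<Longrightarrow> \<exists>x\<in>A. en A = H x"
  unfolding energy_def using Min_in[of "H ` A"] by fastforce

lemma bottom_nonempty: "A \<noteq> {} \<Longrightarrow> bottom H A \<noteq> {}"
  using energy_attained[of A] by (auto simp: bottom_def)

lemma bottom_subset: "bottom H A \<subseteq> A"
  by (auto simp: bottom_def)

lemma boundary_iff: "z \<in> bd C \<longleftrightarrow> z \<notin> C \<and> (\<exists>c\<in>C. E z c)"
  by (auto simp: boundary_def)

lemma boundaryI: "E u v \<Longrightarrow> u \<in> C \<Longrightarrow> v \<notin> C \<Longrightarrow> v \<in> bd C"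
  using E_sym by (auto simp: boundary_iff)

lemma ground_states_nonempty: "ground_states H \<noteq> {}"
  unfolding ground_states_def by (rule bottom_nonempty) simp

lemma ground_states_le: "s \<in> ground_states H \<Longrightarrow> H s \<le> H x"
  using energy_le[of x UNIV] by (simp add: ground_states_def bottom_def)

lemma comm_height_ground_le: "s \<in> ground_states H \<Longrightarrow> s' \<in> ground_states H \<Longrightarrow> \<Phi> s s' \<le> \<Phi>bar"
proof -
  have M: "{\<Phi> s s' | s s'. s \<in> ground_states H \<and> s' \<in> ground_states H}
    = (\<lambda>(a, b). \<Phi> a b) ` (ground_states H \<times> ground_states H)" by auto
  assume "s \<in> ground_states H" "s' \<in> ground_states H"
  then show ?thesis unfolding Phi_bar_def M by (intro Max_ge) auto
qed

lemma Omega_bar_iff: "x \<in> Obar \<longleftrightarrow> (\<exists>s\<in>ground_states H. \<Phi> s x \<le> \<Phi>bar)"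
  using comm_height_sets_le[OF ground_states_nonempty, of "{x}" _ x]
    comm_height_sets_attained[OF ground_states_nonempty, of "{x}"]
  unfolding Omega_bar_def by force

lemma comm_height_Omega_bar: "x \<in> Obar \<Longrightarrow> y \<in> Obar \<Longrightarrow> \<Phi> x y \<le> \<Phi>bar"
  unfolding Omega_bar_iff by (metis comm_height_ground_le comm_height_sym comm_height_trans)

lemma Omega_bar_closed: "x \<in> Obar \<Longrightarrow> \<Phi> x y \<le> \<Phi>bar \<Longrightarrow> y \<in> Obar"
  unfolding Omega_bar_iff by (metis comm_height_trans)

lemma Omega_bar_energy: "x \<in> Obar \<Longrightarrow> H x \<le> \<Phi>bar"
  using comm_height_Omega_bar[of x x] by simp

lemma ground_states_Omega_bar: "s \<in> ground_states H \<Longrightarrow> s \<in> Obar"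
  unfolding Omega_bar_iff using comm_height_ground_le by blast

lemma Omega_bar_edge: "x \<in> Obar \<Longrightarrow> E x y \<Longrightarrow> H y \<le> \<Phi>bar \<Longrightarrow> y \<in> Obar"
  using Omega_bar_closed comm_height_edge Omega_bar_energy by blast

text \<open>
  Taking \<open>x = y\<close> shows that \<open>H\<close> is smaller on \<open>C\<close> than on its boundary, and then the condition says
  that any two points of \<open>C\<close> are joined inside \<open>C\<close>; so this is the usual notion of a cycle.
\<close>

definition cycle :: "'a set \<Rightarrow> bool" where
  "cycle C \<longleftrightarrow> C \<noteq> {} \<and> (\<forall>x\<in>C. \<forall>y\<in>C. \<forall>z\<in>bd C. \<Phi> x y < H z)"

lemma cycle_less: "cycle C \<Longrightarrow> x \<in> C \<Longrightarrow> y \<in> C \<Longrightarrow> z \<in> bd C \<Longrightarrow> \<Phi> x y < H z"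
  by (auto simp: cycle_def)

text \<open>With \<open>c\<close> only in \<open>C\<close>, \<open>d\<close> only in
  \<open>D\<close> and \<open>p\<close> in both, the way from \<open>p\<close> to \<open>d\<close>
  leaves \<open>C\<close>, so it is higher than the way from \<open>p\<close> to \<open>c\<close>;
  by symmetry it is also lower.\<close>

lemma cycle_nested:
  assumes C: "cycle C" and D: "cycle D" and ne: "C \<inter> D \<noteq> {}"
  shows "C \<subseteq> D \<or> D \<subseteq> C"
proof (rule ccontr)
  assume "\<not> ?thesis"
  then obtain c d where cd: "c \<in> C" "c \<notin> D" "d \<in> D" "d \<notin> C" by blast
  from ne obtain p where p: "p \<in> C" "p \<in> D" by blast
  from comm_height_crossing[OF p(1) cd(4)] obtain u v where
    uv: "E u v" "u \<in> C" "v \<notin> C" "H v \<le> \<Phi> p d" by metis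
  then have "\<Phi> p c < H v" using C p cd by (blast intro: cycle_less boundaryI)
  moreover from comm_height_crossing[OF p(2) cd(2)] obtain u' v' where
    uv': "E u' v'" "u' \<in> D" "v' \<notin> D" "H v' \<le> \<Phi> p c" by metis
  then have "\<Phi> p d < H v'" using D p cd by (blast intro: cycle_less boundaryI)
  ultimately show False using uv uv' by linarith
qed

lemma cycle_boundary_less: "cycle C \<Longrightarrow> x \<in> C \<Longrightarrow> z \<in> bd C \<Longrightarrow> H x < H z"
  unfolding cycle_def by (metis comm_height_refl)

text \<open>Each endpoint would lie on the boundary of the other cycle and so be higher than the
  other endpoint.\<close>

lemma cycles_not_adjacent:
  assumes "cycle C" "cycle D" "C \<inter> D = {}" "x \<in> C" "y \<in> D"
  shows "\<not> E x y"
proof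
  assume "E x y"
  with assms have "x \<in> bd D" "y \<in> bd C" using E_sym by (auto simp: boundary_iff)
  with assms show False using cycle_boundary_less by (meson less_asym)
qed

text \<open>The exit level as an absolute energy, comparable between plateaux of different energies;
  \<open>Gam\<close> is relative to the bottom.\<close>

definition barrier :: "'a set set \<Rightarrow> 'a set \<Rightarrow> real" where
  "barrier \<P> P = \<Phi>s P (\<Union>(\<P> - {P}))"

lemma Gam_eq: "Gam E H \<P> P = barrier \<P> P - en P"
  by (simp add: Gam_def barrier_def)

end

text \<open>Beyond the first level a plateau is a union that may be disconnected;
  \<open>inner\<close> says that it is held together below its own barrier. Taken at a single point
  it also yields disjointness.\<close>

locale plateaux = landscape +
  fixes \<P> :: "'a set set"
  assumes nonempty: "P \<in> \<P> \<Longrightarrow> P \<noteq> {}"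
    and ex_other: "P \<in> \<P> \<Longrightarrow> \<exists>Q\<in>\<P>. Q \<noteq> P"
    and ex_plateau: "\<P> \<noteq> {}"
    and in_Omega_bar: "P \<in> \<P> \<Longrightarrow> P \<subseteq> Obar"
    and const_energy: "P \<in> \<P> \<Longrightarrow> x \<in> P \<Longrightarrow> y \<in> P \<Longrightarrow> H x = H y"
    and inner: "P \<in> \<P> \<Longrightarrow> x \<in> P \<Longrightarrow> y \<in> P \<Longrightarrow> \<Phi> x y < barrier \<P> P"
    and descent: "\<eta> \<in> Obar \<Longrightarrow> \<eta> \<notin> \<Union>\<P> \<Longrightarrow>
      \<exists>p\<in>\<Union>\<P>. H p < H \<eta> \<and> (\<forall>\<xi>\<in>\<Union>\<P>. H \<eta> \<le> H \<xi> \<longrightarrow> \<Phi> \<eta> p \<le> \<Phi> \<eta> \<xi>)"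
begin

abbreviation "V \<equiv> valley E H \<P>"
abbreviation "bar \<equiv> barrier \<P>"
abbreviation "\<Gamma> \<equiv> Gam_star E H \<P>"

lemma energy_eq: "P \<in> \<P> \<Longrightarrow> x \<in> P \<Longrightarrow> H x = en P"
  by (metis empty_iff energy_attained const_energy)

lemma others_nonempty:
  assumes "P \<in> \<P>"
  shows "\<Union>(\<P> - {P}) \<noteq> {}"
proof -
  from ex_other[OF assms] obtain Q where Q: "Q \<in> \<P>" "Q \<noteq> P" by blast
  moreover from nonempty[OF Q(1)] obtain x where "x \<in> Q" by blast
  ultimately have "x \<in> \<Union>(\<P> - {P})" by blast
  then show ?thesis by blast
qed

lemma barrier_le:
  assumes "P \<in> \<P>" "Q \<in> \<P>" "P \<noteq> Q" "x \<in> P" "y \<in> Q"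
  shows "bar P \<le> \<Phi> x y"
  unfolding barrier_def using assms
  by (intro comm_height_sets_le nonempty others_nonempty) blast+

lemma barrier_attained:
  assumes "P \<in> \<P>"
  obtains x Q y where "x \<in> P" "Q \<in> \<P>" "Q \<noteq> P" "y \<in> Q" "bar P = \<Phi> x y"
proof -
  from comm_height_sets_attained[OF nonempty[OF assms] others_nonempty[OF assms]]
  obtain x y where "x \<in> P" "y \<in> \<Union>(\<P> - {P})" "bar P = \<Phi> x y"
    unfolding barrier_def by blast
  then show ?thesis using that by blast
qed

lemma disjoint:
  assumes "P \<in> \<P>" "Q \<in> \<P>" "x \<in> P" "x \<in> Q"
  shows "P = Q"
proof (rule ccontr)
  assume "P \<noteq> Q"
  then have "bar P \<le> \<Phi> x x" using barrier_le[of P Q x x] assms by simp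
  with inner[of P x x] assms show False by simp
qed

lemma barrier_le_Phi_bar:
  assumes "P \<in> \<P>"
  shows "bar P \<le> \<Phi>bar"
proof -
  from barrier_attained[OF assms] obtain x Q y where
    xy: "x \<in> P" "Q \<in> \<P>" "y \<in> Q" "bar P = \<Phi> x y" .
  then have "x \<in> Obar" "y \<in> Obar" using in_Omega_bar assms by blast+
  then show ?thesis using comm_height_Omega_bar xy(4) by simp
qed

lemma valley_iff:
  assumes "P \<in> \<P>"
  shows "\<eta> \<in> V P \<longleftrightarrow> (\<exists>p\<in>P. \<Phi> p \<eta> < bar P)"
proof -
  have "\<eta> \<in> V P \<longleftrightarrow> \<Phi>s P {\<eta>} < bar P" by (simp add: valley_def Gam_eq)
  also have "\<dots> \<longleftrightarrow> (\<exists>p\<in>P. \<Phi> p \<eta> < bar P)"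
    using comm_height_sets_le[OF nonempty[OF assms], of "{\<eta>}" _ \<eta>]
      comm_height_sets_attained[OF nonempty[OF assms], of "{\<eta>}"] by force
  finally show ?thesis .
qed

lemma subset_valley: "P \<in> \<P> \<Longrightarrow> P \<subseteq> V P"
  using inner by (auto simp: valley_iff)

lemma valley_subset_Omega_bar:
  assumes "P \<in> \<P>"
  shows "V P \<subseteq> Obar"
proof
  fix x assume "x \<in> V P"
  then obtain p where p: "p \<in> P" "\<Phi> p x < bar P" using assms by (auto simp: valley_iff)
  then have "p \<in> Obar" "\<Phi> p x \<le> \<Phi>bar" using in_Omega_bar barrier_le_Phi_bar assms by fastforce+
  then show "x \<in> Obar" by (rule Omega_bar_closed)
qed

lemma valley_comm_height:
  assumes "P \<in> \<P>" "x \<in> V P" "y \<in> V P"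
  shows "\<Phi> x y < bar P"
proof -
  obtain p q where "p \<in> P" "\<Phi> p x < bar P" "q \<in> P" "\<Phi> q y < bar P"
    using assms by (auto simp: valley_iff)
  then have "\<Phi> x p < bar P" "\<Phi> p q < bar P" "\<Phi> q y < bar P"
    using inner[OF assms(1)] comm_height_sym[of x p] by auto
  then show ?thesis using comm_height_trans_less by blast
qed

lemma valley_boundary:
  assumes "P \<in> \<P>" "z \<in> bd (V P)"
  shows "bar P \<le> H z"
proof (rule ccontr)
  assume "\<not> bar P \<le> H z"
  moreover from assms obtain v where v: "v \<in> V P" "E z v" "z \<notin> V P" using assms by (auto simp: boundary_iff)
  moreover obtain p where p: "p \<in> P" "\<Phi> p v < bar P" using v assms by (auto simp: valley_iff)
  moreover have "H v < bar P" using p(2) comm_height_ge_right[of v p] by simp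
  ultimately have "\<Phi> v z < bar P"
    using comm_height_edge[OF E_sym[OF v(2)], of "max (H v) (H z)"] by simp
  then have "\<Phi> p z < bar P" using p comm_height_trans_less by blast
  with p(1) v(3) assms(1) show False by (auto simp: valley_iff)
qed

lemma valley_nonempty: "P \<in> \<P> \<Longrightarrow> V P \<noteq> {}"
  using subset_valley nonempty by blast

lemma cycle_valley:
  assumes "P \<in> \<P>"
  shows "cycle (V P)"
  unfolding cycle_def
  using valley_nonempty[OF assms] valley_comm_height[OF assms] valley_boundary[OF assms]
  by (meson less_le_trans)

text \<open>A common point would join the two plateaux strictly below \<Phi> \<open>p q\<close>, by
  the ultrametric inequality.\<close>

lemma valleys_disjoint:
  assumes "P \<in> \<P>" "Q \<in> \<P>" "P \<noteq> Q"
  shows "V P \<inter> V Q = {}"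
proof (rule ccontr)
  assume "V P \<inter> V Q \<noteq> {}"
  then obtain x where "x \<in> V P" "x \<in> V Q" by blast
  then obtain p q where "p \<in> P" "q \<in> Q" "\<Phi> p x < bar P" "\<Phi> q x < bar Q"
    unfolding valley_iff[OF assms(1)] valley_iff[OF assms(2)] by blast
  moreover from this have "bar P \<le> \<Phi> p q" "bar Q \<le> \<Phi> p q"
    using barrier_le[of P Q p q] barrier_le[of Q P q p] assms comm_height_sym[of p q] by auto
  ultimately show False
    using comm_height_trans[of p x "max (\<Phi> p x) (\<Phi> q x)" q] comm_height_sym[of x q] by auto
qed

lemma valley_exit:
  assumes "P \<in> \<P>"
  obtains z where "z \<in> bd (V P)" "H z \<le> bar P"
proof -
  from barrier_attained[OF assms] obtain x Q y where
    xy: "x \<in> P" "Q \<in> \<P>" "Q \<noteq> P" "y \<in> Q" "bar P = \<Phi> x y" .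
  have "y \<notin> V P" using valleys_disjoint[of P Q] subset_valley xy assms by blast
  moreover have "x \<in> V P" using xy subset_valley assms by blast
  ultimately obtain u v where "E u v" "u \<in> V P" "v \<notin> V P" "H v \<le> \<Phi> x y"
    using comm_height_crossing by metis
  then show ?thesis using that[of v] xy(5) boundaryI by simp
qed

text \<open>A boundary point below the barrier would belong to the valley, while an optimal path to
  another plateau crosses the boundary no higher than the barrier.\<close>

lemma energy_boundary_valley:
  assumes "P \<in> \<P>"
  shows "en (bd (V P)) = bar P"
proof -
  from valley_exit[OF assms] obtain z where z: "z \<in> bd (V P)" "H z \<le> bar P" .
  then obtain w where "w \<in> bd (V P)" "en (bd (V P)) = H w" using energy_attained by blast
  then have "bar P \<le> en (bd (V P))" using valley_boundary assms by simp
  then show ?thesis using z energy_le[OF z(1)] by simp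
qed

text \<open>Let \<open>\<eta>\<close> be a point of the valley outside all plateaux with energy at
  most \<open>en P\<close>. Then \<open>descent\<close>, compared with a point of \<open>P\<close>,
  gives a strictly lower plateau point that is still within the barrier of \<open>P\<close>. Being
  lower it is not in \<open>P\<close>, and no other plateau is that close.\<close>

lemma bottom_valley:
  assumes P: "P \<in> \<P>"
  shows "bottom H (V P) = P" and "en (V P) = en P"
proof -
  have *: "\<eta> \<in> P" if \<eta>: "\<eta> \<in> V P" "H \<eta> \<le> en P" for \<eta>
  proof (cases "\<eta> \<in> \<Union>\<P>")
    case True
    then show ?thesis using \<eta>(1) P valleys_disjoint subset_valley by blast
  next
    case False
    have "\<eta> \<in> Obar" using \<eta>(1) valley_subset_Omega_bar P by blast
    from descent[OF this False] obtain p where p: "p \<in> \<Union>\<P>" "H p < H \<eta>"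
      "\<And>\<xi>. \<xi> \<in> \<Union>\<P> \<Longrightarrow> H \<eta> \<le> H \<xi> \<Longrightarrow> \<Phi> \<eta> p \<le> \<Phi> \<eta> \<xi>" by blast
    obtain q where q: "q \<in> P" "\<Phi> q \<eta> < bar P" using \<eta>(1) P by (auto simp: valley_iff)
    have "\<Phi> \<eta> p \<le> \<Phi> \<eta> q" using p(3)[of q] q(1) P \<eta>(2) energy_eq by auto
    then have "\<Phi> \<eta> p < bar P" using q(2) comm_height_sym[of q \<eta>] by simp
    then have "\<Phi> q p < bar P" using q(2) comm_height_trans_less by blast
    moreover have "p \<notin> P" using p(2) \<eta>(2) energy_eq[OF P, of p] by auto
    ultimately show ?thesis using barrier_le P p(1) q(1) by (metis UnionE linorder_not_less)
  qed
  obtain p where p: "p \<in> P" using nonempty[OF P] by blast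
  have le: "en (V P) \<le> en P" using p energy_le[of p "V P"] subset_valley[OF P] energy_eq[OF P p] by auto
  obtain x where x: "x \<in> V P" "en (V P) = H x"
    using energy_attained[of "V P"] p subset_valley[OF P] by blast
  then have "x \<in> P" using * le by simp
  then show en: "en (V P) = en P" using x energy_eq[OF P] by simp
  show "bottom H (V P) = P"
    using * subset_valley[OF P] energy_eq[OF P] by (auto simp: bottom_def en)
qed

lemma depth_valley: "P \<in> \<P> \<Longrightarrow> depth E H (V P) = bar P - en P"
  by (simp add: depth_def energy_boundary_valley bottom_valley)

lemma Gam_star_le: "P \<in> \<P> \<Longrightarrow> \<Gamma> \<le> bar P - en P"
  unfolding Gam_star_def Gam_eq[symmetric] by (intro Min_le) auto

lemma Gam_star_attained: "\<exists>P\<in>\<P>. \<Gamma> = bar P - en P"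
proof -
  have "\<Gamma> \<in> Gam E H \<P> ` \<P>"
    unfolding Gam_star_def using ex_plateau by (intro Min_in) auto
  then show ?thesis by (auto simp: Gam_eq)
qed

end

section \<open>The contracted chain\<close>

text \<open>A nonempty boundary makes \<open>en (bd C)\<close> a true minimum, and
  \<open>exit_le\<close> keeps the lowest exits inside \<open>Obar\<close>, where the chain
  lives.\<close>

locale cycle_family = landscape +
  fixes \<C> :: "'a set set" and \<gamma> :: real
  assumes cycles: "C \<in> \<C> \<Longrightarrow> cycle C"
    and cycles_disjoint: "C \<in> \<C> \<Longrightarrow> D \<in> \<C> \<Longrightarrow> C \<noteq> D \<Longrightarrow> C \<inter> D = {}"
    and cycles_in_Omega_bar: "C \<in> \<C> \<Longrightarrow> C \<subseteq> Obar"
    and boundary_nonempty: "C \<in> \<C> \<Longrightarrow> bd C \<noteq> {}"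
    and exit_le: "C \<in> \<C> \<Longrightarrow> en (bd C) \<le> \<Phi>bar"
begin

abbreviation "btm \<equiv> bottom H"
abbreviation "\<Delta> \<equiv> Delta E H \<C>"
abbreviation "JS \<equiv> jump_states E H \<C>"
abbreviation "jr \<equiv> jump_rate E H \<C> \<gamma>"
abbreviation "TS \<equiv> trace_states E H \<C> \<gamma>"

definition step :: "'a + 'a set \<Rightarrow> 'a + 'a set \<Rightarrow> bool" where
  "step x y \<longleftrightarrow> x \<in> JS \<and> y \<in> JS \<and> x \<noteq> y \<and> 0 < jr x y"

lemma cycle_nonempty: "C \<in> \<C> \<Longrightarrow> C \<noteq> {}"
  using cycles cycle_def by auto

lemma bottom_inj:
  assumes "C \<in> \<C>" "D \<in> \<C>" "btm C = btm D"
  shows "C = D"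
proof (rule ccontr)
  assume "C \<noteq> D"
  then have "C \<inter> D = {}" using cycles_disjoint assms by blast
  moreover have "btm C \<noteq> {}" "btm C \<subseteq> C" "btm C \<subseteq> D"
    using bottom_nonempty[OF cycle_nonempty[OF assms(1)]] bottom_subset[of C] bottom_subset[of D] assms(3)
    by auto
  ultimately show False by blast
qed

lemma cycle_of_bottom [simp]: "C \<in> \<C> \<Longrightarrow> cycle_of H \<C> (btm C) = C"
  unfolding cycle_of_def by (rule the_equality) (use bottom_inj in blast)+

lemma Inl_JS [simp]: "Inl \<eta> \<in> JS \<longleftrightarrow> \<eta> \<in> \<Delta>"
  by (auto simp: jump_states_def)

lemma Inr_JS: "C \<in> \<C> \<Longrightarrow> Inr (btm C) \<in> JS"
  by (auto simp: jump_states_def)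

lemma JS_cases:
  assumes "x \<in> JS"
  obtains \<eta> where "x = Inl \<eta>" "\<eta> \<in> \<Delta>" | C where "x = Inr (btm C)" "C \<in> \<C>"
  using assms by (auto simp: jump_states_def)

lemma Delta_Omega_bar: "\<eta> \<in> \<Delta> \<Longrightarrow> \<eta> \<in> Obar"
  by (simp add: Delta_def)

lemma Delta_not_cycle: "\<eta> \<in> \<Delta> \<Longrightarrow> C \<in> \<C> \<Longrightarrow> \<eta> \<notin> C"
  by (auto simp: Delta_def)

lemma boundary_star_iff: "\<eta> \<in> boundary_star E H C \<longleftrightarrow> \<eta> \<in> bd C \<and> H \<eta> = en (bd C)"
  by (simp add: boundary_star_def bottom_def)

lemma card_neighbours_pos: "\<eta> \<in> bd C \<Longrightarrow> 0 < card {\<zeta> \<in> C. E \<eta> \<zeta>}"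
  by (auto simp: card_gt_0_iff boundary_iff)

lemma jr_nonneg: "0 \<le> jr x y"
  by (cases x; cases y) (simp_all add: Let_def)

lemma step_Inl_Inl: "step (Inl \<eta>) (Inl \<xi>) \<longleftrightarrow> \<eta> \<in> \<Delta> \<and> \<xi> \<in> \<Delta> \<and> E \<eta> \<xi> \<and> H \<xi> \<le> H \<eta>"
  using E_irrefl by (auto simp: step_def)

lemma step_Inl_Inr:
  "C \<in> \<C> \<Longrightarrow> step (Inl \<eta>) (Inr (btm C)) \<longleftrightarrow> \<eta> \<in> \<Delta> \<and> \<eta> \<in> bd C"
  using card_neighbours_pos by (auto simp: step_def Inr_JS)

lemma step_Inr_Inl:
  assumes "C \<in> \<C>"
  shows "step (Inr (btm C)) (Inl \<eta>) \<longleftrightarrow>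
    \<eta> \<in> \<Delta> \<and> depth E H C \<le> \<gamma> \<and> \<eta> \<in> bd C \<and> H \<eta> = en (bd C)"
proof -
  have "0 < card (btm C)"
    using bottom_nonempty[OF cycle_nonempty[OF assms]] by (simp add: card_gt_0_iff)
  then show ?thesis
    using assms card_neighbours_pos by (auto simp: step_def Inr_JS boundary_star_iff Let_def)
qed

lemma not_step_Inr_Inr: "\<not> step (Inr B) (Inr B')"
  by (simp add: step_def)

lemma step_JS: "step x y \<Longrightarrow> x \<in> JS" "step x y \<Longrightarrow> y \<in> JS"
  by (auto simp: step_def)

lemma step_cases [consumes 1, case_names flat enter exit]:
  assumes "step x y"
  obtains \<eta> \<xi> where "x = Inl \<eta>" "y = Inl \<xi>" "\<eta> \<in> \<Delta>" "\<xi> \<in> \<Delta>" "E \<eta> \<xi>" "H \<xi> \<le> H \<eta>"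
  | \<eta> C where "x = Inl \<eta>" "y = Inr (btm C)" "C \<in> \<C>" "\<eta> \<in> \<Delta>" "\<eta> \<in> bd C"
  | \<eta> C where "x = Inr (btm C)" "y = Inl \<eta>" "C \<in> \<C>" "\<eta> \<in> \<Delta>" "depth E H C \<le> \<gamma>"
      "\<eta> \<in> bd C" "H \<eta> = en (bd C)"
  using step_JS(1)[OF assms]
proof (cases rule: JS_cases)
  case x: (1 \<eta>)
  show ?thesis using step_JS(2)[OF assms]
    by (cases rule: JS_cases) (use assms that x in \<open>auto simp: step_Inl_Inl step_Inl_Inr\<close>)
next
  case x: (2 C)
  show ?thesis using step_JS(2)[OF assms]
    by (cases rule: JS_cases) (use assms that x in \<open>auto simp: step_Inr_Inl not_step_Inr_Inr\<close>)
qed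

lemma steps_JS: "step\<^sup>*\<^sup>* x y \<Longrightarrow> x \<in> JS \<Longrightarrow> y \<in> JS"
  by (induction rule: rtranclp_induct) (auto simp: step_def)

lemma TS_iff: "B \<in> TS \<longleftrightarrow> (\<exists>C\<in>\<C>. B = btm C \<and> \<gamma> \<le> depth E H C)"
  by (auto simp: trace_states_def deep_cycles_def)

lemma TS_JS: "B \<in> TS \<Longrightarrow> Inr B \<in> JS"
  by (auto simp: TS_iff Inr_JS)

lemma trace_rate_pos_iff:
  assumes "B' \<in> TS"
  shows "0 < trace_rate E H \<C> \<gamma> B B' \<longleftrightarrow>
    (\<exists>\<eta>\<in>\<Delta>. 0 < jr (Inr B) (Inl \<eta>) \<and> (step_before JS jr (Inr ` TS))\<^sup>*\<^sup>* (Inl \<eta>) (Inr B'))"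
proof -
  let ?p = "\<lambda>\<eta>. first_hit_prob JS jr (Inl \<eta>) (Inr ` TS) (Inr B')"
  have p: "0 < ?p \<eta> \<longleftrightarrow> (step_before JS jr (Inr ` TS))\<^sup>*\<^sup>* (Inl \<eta>) (Inr B')" if "\<eta> \<in> \<Delta>" for \<eta>
    using assms that jr_nonneg by (intro first_hit_prob_pos_iff) auto
  have nn: "0 \<le> jr (Inr B) (Inl \<eta>) * ?p \<eta>" for \<eta>
    using jr_nonneg by (simp add: first_hit_prob_def del: jump_rate.simps)
  have pos: "0 < jr (Inr B) (Inl \<eta>) * ?p \<eta> \<longleftrightarrow> 0 < jr (Inr B) (Inl \<eta>) \<and> 0 < ?p \<eta>" for \<eta>
    using jr_nonneg[of "Inr B" "Inl \<eta>"]
    by (auto simp: zero_less_mult_iff simp del: jump_rate.simps)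
  have "0 < trace_rate E H \<C> \<gamma> B B' \<longleftrightarrow> (\<exists>\<eta>\<in>\<Delta>. 0 < jr (Inr B) (Inl \<eta>) * ?p \<eta>)"
    unfolding trace_rate_def using nn
    by (metis (no_types, lifting) finite_code sum_nonneg sum_nonneg_eq_0_iff less_eq_real_def less_irrefl)
  with p pos show ?thesis by auto
qed

lemma step_before_step: "(step_before JS jr A)\<^sup>*\<^sup>* x y \<Longrightarrow> step\<^sup>*\<^sup>* x y"
  by (erule rtranclp_mono[THEN predicate2D, rotated]) (auto simp: step_before_def step_def)

text \<open>Cuts a path of the contracted chain at its visits to trace states. The induction runs
  backwards because the first hit from \<open>x\<close> is either \<open>x\<close> itself or the
  first hit from its successor.\<close>

lemma steps_first_trace_state:
  assumes "step\<^sup>*\<^sup>* x (Inr B')" "B' \<in> TS" "x \<in> JS"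
  shows "\<exists>B\<in>TS. (step_before JS jr (Inr ` TS))\<^sup>*\<^sup>* x (Inr B) \<and>
    leads_to TS (trace_rate E H \<C> \<gamma>) B B'"
  using assms(1,3)
proof (induction rule: converse_rtranclp_induct)
  case base
  then show ?case using assms(2) by (auto simp: leads_to_def)
next
  case (step x y)
  from step.IH step_JS(2)[OF step(1)] obtain B where B: "B \<in> TS"
      "(step_before JS jr (Inr ` TS))\<^sup>*\<^sup>* y (Inr B)" "leads_to TS (trace_rate E H \<C> \<gamma>) B B'"
    by blast
  show ?case
  proof (cases "x \<in> Inr ` TS")
    case False
    then have "step_before JS jr (Inr ` TS) x y"
      using step(1) by (auto simp: step_def step_before_def simp del: jump_rate.simps)
    then show ?thesis using B by (meson converse_rtranclp_into_rtranclp)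
  next
    case True
    then obtain D where D: "x = Inr D" "D \<in> TS" by blast
    from step(1) obtain \<eta> where \<eta>: "y = Inl \<eta>" "\<eta> \<in> \<Delta>"
      by (cases rule: step_cases) (use D in auto)
    have "0 < jr (Inr D) (Inl \<eta>)" using step(1) D \<eta> by (simp add: step_def del: jump_rate.simps)
    then have "0 < trace_rate E H \<C> \<gamma> D B"
      using trace_rate_pos_iff[OF B(1)] B(2) \<eta> by blast
    then have "leads_to TS (trace_rate E H \<C> \<gamma>) D B'"
      \<comment> \<open>If \<open>D = B\<close>, the excursion returns to its origin, which is no
        jump of the trace chain.\<close>
      using B(1,3) D(2) unfolding leads_to_def
      by (cases "D = B") (auto intro: converse_rtranclp_into_rtranclp)
    then show ?thesis using D by blast
  qed
qed

lemma leads_to_trace: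
  assumes "B \<in> TS" "B' \<in> TS"
  shows "leads_to TS (trace_rate E H \<C> \<gamma>) B B' \<longleftrightarrow> step\<^sup>*\<^sup>* (Inr B) (Inr B')"
proof
  assume "leads_to TS (trace_rate E H \<C> \<gamma>) B B'"
  then show "step\<^sup>*\<^sup>* (Inr B) (Inr B')"
    unfolding leads_to_def
  proof (induction rule: rtranclp_induct)
    case (step D D')
    then have "D' \<in> TS" "0 < trace_rate E H \<C> \<gamma> D D'" "D \<in> TS" by auto
    from this(2) obtain \<eta> where \<eta>: "\<eta> \<in> \<Delta>" "0 < jr (Inr D) (Inl \<eta>)"
        "(step_before JS jr (Inr ` TS))\<^sup>*\<^sup>* (Inl \<eta>) (Inr D')"
      using trace_rate_pos_iff[OF \<open>D' \<in> TS\<close>] by blast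
    then have "step (Inr D) (Inl \<eta>)"
      using TS_JS[OF \<open>D \<in> TS\<close>] by (simp add: step_def del: jump_rate.simps)
    with step.IH step_before_step[OF \<eta>(3)] show ?case
      by (meson rtranclp.rtrancl_into_rtrancl rtranclp_trans)
  qed simp
next
  assume "step\<^sup>*\<^sup>* (Inr B) (Inr B')"
  from steps_first_trace_state[OF this assms(2) TS_JS[OF assms(1)]] obtain D where
    D: "D \<in> TS" "(step_before JS jr (Inr ` TS))\<^sup>*\<^sup>* (Inr B) (Inr D)"
      "leads_to TS (trace_rate E H \<C> \<gamma>) D B'" by blast
  \<comment> \<open>\<open>Inr B\<close> is itself a trace state, so no restricted step can start
    there and the path is empty.\<close>
  from D(2) have "D = B"
    by (cases rule: converse_rtranclpE) (use assms in \<open>auto simp: step_before_def\<close>)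
  with D show "leads_to TS (trace_rate E H \<C> \<gamma>) B B'" by simp
qed

section \<open>Exit levels along trajectories of the contracted chain\<close>

fun height :: "'a + 'a set \<Rightarrow> real" where
  "height (Inl \<eta>) = H \<eta>"
| "height (Inr B) = en (bd (cycle_of H \<C> B))"

fun points :: "'a + 'a set \<Rightarrow> 'a set" where
  "points (Inl \<eta>) = {\<eta>}"
| "points (Inr B) = cycle_of H \<C> B"

lemma points_nonempty: "x \<in> JS \<Longrightarrow> points x \<noteq> {}"
  by (erule JS_cases) (auto simp: cycle_nonempty)

lemma points_Omega_bar: "x \<in> JS \<Longrightarrow> points x \<subseteq> Obar"
  by (erule JS_cases) (auto simp: cycles_in_Omega_bar Delta_Omega_bar)

text \<open>A cycle is entered from a point of its boundary, which lies no lower than the exit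
  level, and left exactly at the exit level.\<close>

lemma step_height: "step x y \<Longrightarrow> height y \<le> height x"
  by (erule step_cases) (auto simp: energy_le)

lemma steps_height: "step\<^sup>*\<^sup>* x y \<Longrightarrow> height y \<le> height x"
  by (induction rule: rtranclp_induct) (auto dest: step_height)

text \<open>If entering a cycle preserves the height, the point of entry is a lowest exit; the depth
  condition on \<open>y\<close> then permits leaving through it.\<close>

lemma step_reverse:
  assumes "step x y" "height x = height y"
    and "\<And>C. C \<in> \<C> \<Longrightarrow> y = Inr (btm C) \<Longrightarrow> depth E H C \<le> \<gamma>"
  shows "step y x"
  using assms(1) by (cases rule: step_cases)
    (use assms(2,3) E_sym in \<open>auto simp: step_Inl_Inl step_Inl_Inr step_Inr_Inl\<close>)

lemma steps_reverse:
  assumes "step\<^sup>*\<^sup>* x y" "height x = height y"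
    and "\<And>C. C \<in> \<C> \<Longrightarrow> y = Inr (btm C) \<Longrightarrow> depth E H C \<le> \<gamma>"
  shows "step\<^sup>*\<^sup>* y x"
  using assms
proof (induction rule: rtranclp_induct)
  case (step y z)
  have eq: "height x = height y" "height y = height z"
    using steps_height[OF step(1)] step_height[OF step(2)] step.prems(1) by auto
  have "step z y" using step(2) eq(2) step.prems(2) by (rule step_reverse)
  \<comment> \<open>An intermediate cycle is left by the trajectory itself, so only the final state
    needs an assumption on its depth.\<close>
  moreover have "depth E H C \<le> \<gamma>" if "C \<in> \<C>" "y = Inr (btm C)" for C
    using step(2) by (cases rule: step_cases) (use that in \<open>auto dest: bottom_inj\<close>)
  then have "step\<^sup>*\<^sup>* y x" using step.IH eq(1) by blast
  ultimately show ?case by (rule converse_rtranclp_into_rtranclp)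
qed simp

lemma cycle_comm_height:
  assumes "C \<in> \<C>" "x \<in> C" "y \<in> C"
  shows "\<Phi> x y < en (bd C)"
  using energy_attained[OF boundary_nonempty[OF assms(1)]] cycle_less[OF cycles[OF assms(1)]] assms
  by auto

lemma entrance_comm_height:
  assumes "C \<in> \<C>" "\<eta> \<in> bd C" "x \<in> C"
  shows "\<Phi> \<eta> x \<le> H \<eta>"
proof -
  obtain c where c: "c \<in> C" "E \<eta> c" using assms(2) by (auto simp: boundary_iff)
  have "H c < H \<eta>" using cycle_boundary_less cycles assms c by blast
  then have "\<Phi> \<eta> c \<le> H \<eta>" using c(2) by (intro comm_height_edge) auto
  moreover have "\<Phi> c x \<le> H \<eta>"
    using cycle_less[OF cycles[OF assms(1)] c(1) assms(3,2)] by simp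
  ultimately show ?thesis by (rule comm_height_trans)
qed

lemma step_comm_height:
  assumes "step x y" "p \<in> points x" "q \<in> points y"
  shows "\<Phi> p q \<le> height x"
  using assms(1)
proof (cases rule: step_cases)
  case (flat \<eta> \<xi>)
  then show ?thesis using assms by (auto intro: comm_height_edge)
next
  case (enter \<eta> C)
  then show ?thesis using assms entrance_comm_height by auto
next
  case (exit \<eta> C)
  then show ?thesis using assms entrance_comm_height[of C \<eta> p] comm_height_sym[of p \<eta>] by auto
qed

lemma steps_comm_height:
  assumes "step\<^sup>*\<^sup>* x y" "x \<in> JS" "p \<in> points x" "q \<in> points y"
  shows "\<Phi> p q \<le> height x"
  using assms
proof (induction arbitrary: p rule: converse_rtranclp_induct)
  case base
  from base(1) show ?case
    by (cases rule: JS_cases) (use base cycle_comm_height in \<open>auto simp: less_imp_le\<close>)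
next
  case (step x z)
  obtain r where r: "r \<in> points z" using points_nonempty step_JS(2)[OF step(1)] by blast
  have "\<Phi> p r \<le> height x" using step_comm_height[OF step(1) step.prems(2) r] .
  moreover have "\<Phi> r q \<le> height x"
    using step.IH[OF step_JS(2)[OF step(1)] r step.prems(3)] step_height[OF step(1)] by simp
  ultimately show ?case by (rule comm_height_trans)
qed

lemma steps_from_cycle:
  assumes "step\<^sup>*\<^sup>* (Inr (btm C)) y" "y \<noteq> Inr (btm C)" "C \<in> \<C>"
  shows "depth E H C \<le> \<gamma>"
  using assms(1)
proof (cases rule: converse_rtranclpE)
  case (step z)
  from step(1) show ?thesis by (cases rule: step_cases) (use assms(3) bottom_inj in auto)
qed (use assms in simp)

text \<open>A neighbour at height at most \<open>L\<close> could be reached by a step, contradicting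
  closedness: from a configuration by moving to it or entering its cycle, from a cycle by using it
  as an exit.\<close>

lemma flat_region_boundary:
  assumes "R \<subseteq> JS" and closed: "\<And>x y. x \<in> R \<Longrightarrow> step x y \<Longrightarrow> y \<in> R"
    and flat: "\<And>x. x \<in> R \<Longrightarrow> height x = L"
    and shallow: "\<And>C. C \<in> \<C> \<Longrightarrow> Inr (btm C) \<in> R \<Longrightarrow> depth E H C \<le> \<gamma>"
    and uv: "E u v" "u \<in> \<Union>(points ` R)" "v \<notin> \<Union>(points ` R)"
  shows "L < H v"
proof (rule ccontr)
  assume "\<not> L < H v"
  then have vL: "H v \<le> L" by simp
  from uv(2) obtain x where x: "x \<in> R" "u \<in> points x" by blast
  have xJ: "x \<in> JS" using x(1) assms(1) by blast
  have uO: "u \<in> Obar" using points_Omega_bar[OF xJ] x(2) by blast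
  have notin: "y \<notin> R" if "v \<in> points y" for y using that uv(3) by blast
  show False using xJ
  proof (cases rule: JS_cases)
    case (1 \<eta>)
    with x flat[OF x(1)] have u: "u = \<eta>" "H u = L" by auto
    have vO: "v \<in> Obar" using Omega_bar_edge[OF uO uv(1)] Omega_bar_energy[OF uO] vL u by simp
    show False
    proof (cases "v \<in> \<Delta>")
      case True
      then have "step x (Inl v)" using 1 u uv(1) vL by (simp add: step_Inl_Inl)
      with closed[OF x(1)] notin[of "Inl v"] show False by simp
    next
      case False
      then obtain C where C: "C \<in> \<C>" "v \<in> C" using vO by (auto simp: Delta_def)
      have "u \<in> bd C" using C uv(1) 1 u Delta_not_cycle by (auto simp: boundary_iff)
      then have "step x (Inr (btm C))" using 1 u C by (simp add: step_Inl_Inr)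
      with closed[OF x(1)] notin[of "Inr (btm C)"] C show False by simp
    qed
  next
    case (2 C)
    have uC: "u \<in> C" "v \<notin> C" using x 2 notin[OF _] by auto
    have L: "en (bd C) = L" using flat[OF x(1)] 2 by simp
    have vb: "v \<in> bd C" using uC uv(1) by (blast intro: boundaryI)
    \<comment> \<open>A boundary point cannot lie below the minimum \<open>L\<close> of the
      boundary, so \<open>v\<close> is a lowest exit.\<close>
    then have Hv: "H v = L" using energy_le[OF vb] L vL by simp
    have vO: "v \<in> Obar" using Omega_bar_edge[OF uO uv(1)] exit_le[OF 2(2)] L Hv by simp
    have "v \<in> \<Delta>"
    proof (rule ccontr)
      assume "v \<notin> \<Delta>"
      then obtain D where D: "D \<in> \<C>" "v \<in> D" using vO by (auto simp: Delta_def)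
      then have "C \<inter> D = {}" using cycles_disjoint[OF 2(2) D(1)] uC by blast
      then show False using cycles_not_adjacent[OF cycles[OF 2(2)] cycles[OF D(1)]] uC D uv(1) by blast
    qed
    then have "step x (Inl v)" using 2 vb Hv L shallow x(1) by (simp add: step_Inr_Inl)
    with closed[OF x(1)] notin[of "Inl v"] show False by simp
  qed
qed

end

section \<open>From one level to the next\<close>

text \<open>The strict bound in \<open>shallow\<close> makes the deep cycles exactly the valleys, so
  the trace chain lives on \<open>\<P>\<close>. By \<open>not_trapped\<close>, no closed part of the
  contracted chain misses the plateaux.\<close>

locale hierarchy_level = plateaux E H \<P> + cycle_family E H \<C> "Gam_star E H \<P>"
  for E :: "'a :: finite \<Rightarrow> 'a \<Rightarrow> bool" and H :: "'a \<Rightarrow> real"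
    and \<P> \<C> :: "'a set set" +
  assumes valley_in: "P \<in> \<P> \<Longrightarrow> V P \<in> \<C>"
    and shallow: "C \<in> \<C> \<Longrightarrow> C \<notin> V ` \<P> \<Longrightarrow> depth E H C < \<Gamma>"
    and not_trapped: "x \<in> JS \<Longrightarrow> \<exists>P\<in>\<P>. step\<^sup>*\<^sup>* x (Inr P)"
begin

abbreviation "CL \<equiv> classes E H (\<P>, \<C>)"
abbreviation "\<P>' \<equiv> Union ` CL"
abbreviation "leads P Q \<equiv> step\<^sup>*\<^sup>* (Inr P) (Inr Q)"

lemma plateau_state:
  assumes "P \<in> \<P>"
  shows "Inr P \<in> JS" "height (Inr P) = bar P" "points (Inr P) = V P"
  using Inr_JS[OF valley_in[OF assms]] cycle_of_bottom[OF valley_in[OF assms]]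
  by (simp_all add: bottom_valley[OF assms] energy_boundary_valley[OF assms])

lemma Inr_eq_plateau_iff: "P \<in> \<P> \<Longrightarrow> C \<in> \<C> \<Longrightarrow> btm C = P \<longleftrightarrow> C = V P"
  using bottom_valley valley_in bottom_inj by metis

lemma deep_iff: "C \<in> \<C> \<Longrightarrow> \<Gamma> \<le> depth E H C \<longleftrightarrow> C \<in> V ` \<P>"
  using shallow Gam_star_le depth_valley by (metis imageE linorder_not_less)

lemma TS_eq: "TS = \<P>"
proof -
  have "deep_cycles E H \<C> \<Gamma> = V ` \<P>"
    using deep_iff valley_in by (auto simp: deep_cycles_def)
  then show ?thesis by (force simp: trace_states_def bottom_valley image_image)
qed

lemma classes_iff:
  "A \<in> CL \<longleftrightarrow> A \<noteq> {} \<and> A \<subseteq> \<P> \<and> (\<forall>P\<in>A. \<forall>Q\<in>A. leads P Q) \<and> (\<forall>P\<in>A. \<forall>Q\<in>\<P> - A. \<not> leads P Q)"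
proof -
  have *: "leads_to \<P> (trace_rate E H \<C> \<Gamma>) P Q \<longleftrightarrow> leads P Q" if "P \<in> \<P>" "Q \<in> \<P>" for P Q
    using leads_to_trace that by (simp add: TS_eq)
  show ?thesis
    unfolding classes_def irreducible_classes_def TS_eq prod.case mem_Collect_eq
    using * by (smt (verit, ccfv_threshold) DiffD1 subsetD)
qed

lemma class_subset: "A \<in> CL \<Longrightarrow> A \<subseteq> \<P>"
  by (simp add: classes_iff)

lemma class_nonempty: "A \<in> CL \<Longrightarrow> A \<noteq> {}"
  by (simp add: classes_iff)

lemma class_leads: "A \<in> CL \<Longrightarrow> P \<in> A \<Longrightarrow> Q \<in> A \<Longrightarrow> leads P Q"
  by (simp add: classes_iff)

lemma class_closed: "A \<in> CL \<Longrightarrow> P \<in> A \<Longrightarrow> Q \<in> \<P> \<Longrightarrow> leads P Q \<Longrightarrow> Q \<in> A"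
  by (auto simp: classes_iff)

lemma class_unique:
  assumes "A \<in> CL" "B \<in> CL" "P \<in> A" "P \<in> B"
  shows "A = B"
proof -
  have "X \<subseteq> Y" if "X \<in> CL" "Y \<in> CL" "P \<in> X" "P \<in> Y" for X Y
  proof
    fix Q assume "Q \<in> X"
    then have "Q \<in> \<P>" "leads P Q" using class_subset class_leads that by blast+
    then show "Q \<in> Y" using class_closed[OF that(2,4)] by blast
  qed
  then show ?thesis using assms by blast
qed

lemma leads_energy:
  assumes "P \<in> \<P>" "Q \<in> \<P>" "leads P Q" "P \<noteq> Q"
  shows "bar P = en P + \<Gamma>" "en Q \<le> en P" "en Q = en P \<Longrightarrow> leads Q P"
proof -
  have "depth E H (V P) \<le> \<Gamma>"
    using steps_from_cycle[of "V P"] assms valley_in bottom_valley by auto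
  then show barP: "bar P = en P + \<Gamma>"
    using Gam_star_le[OF assms(1)] depth_valley[OF assms(1)] by simp
  have le: "bar Q \<le> bar P"
    using steps_height[OF assms(3)] plateau_state assms by simp
  then show "en Q \<le> en P" using barP Gam_star_le[OF assms(2)] by simp
  assume "en Q = en P"
  \<comment> \<open>Equal bottoms squeeze \<open>bar Q\<close> between
    \<open>en Q + \<Gamma>\<close> and \<open>bar P\<close>. So \<open>V Q\<close> has depth exactly
    \<Gamma>, as reversal requires at its end point.\<close>
  then have barQ: "bar Q = bar P" using le barP Gam_star_le[OF assms(2)] by simp
  show "leads Q P"
  proof (rule steps_reverse[OF assms(3)])
    show "height (Inr P) = height (Inr Q)" using barQ plateau_state assms by simp
    fix C assume "C \<in> \<C>" "Inr Q = Inr (btm C)"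
    then have "C = V Q" using Inr_eq_plateau_iff assms(2) by blast
    then show "depth E H C \<le> \<Gamma>"
      using depth_valley[OF assms(2)] barQ barP \<open>en Q = en P\<close> by simp
  qed
qed

lemma class_energy:
  assumes "A \<in> CL" "P \<in> A" "Q \<in> A"
  shows "en P = en Q"
proof (cases "P = Q")
  case False
  have "P \<in> \<P>" "Q \<in> \<P>" using class_subset assms by blast+
  then show ?thesis
    using leads_energy(2)[of P Q] leads_energy(2)[of Q P] class_leads[OF assms(1)] assms False
    by (intro order.antisym) auto
qed simp

text \<open>Take \<open>Q\<close> of least energy among the plateaux reachable from
  \<open>P\<close>. Whatever \<open>Q\<close> reaches has the same energy and hence leads back, so
  the set reachable from \<open>Q\<close> is a class.\<close>

lemma leads_to_class:
  assumes P: "P \<in> \<P>"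
  obtains A Q where "A \<in> CL" "Q \<in> A" "leads P Q"
proof -
  let ?S = "{Q \<in> \<P>. leads P Q}"
  have "P \<in> ?S" using P by simp
  then obtain Q where Q: "Q \<in> ?S" "\<And>Q'. Q' \<in> ?S \<Longrightarrow> en Q \<le> en Q'"
    using ex_min_if_finite[of "en ` ?S"] by (force simp: not_less)
  define A where "A = {Q' \<in> \<P>. leads Q Q'}"
  have return: "leads Q' Q" if "Q' \<in> A" for Q'
  proof (cases "Q' = Q")
    case False
    from that have Q': "Q' \<in> \<P>" "leads Q Q'" by (auto simp: A_def)
    moreover have "Q' \<in> ?S" using Q(1) Q' by auto
    ultimately show ?thesis
      using leads_energy(2,3)[of Q Q'] Q False by (metis (lifting) mem_Collect_eq order.antisym)
  qed simp
  have "A \<in> CL"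
    unfolding classes_iff
  proof (intro conjI ballI)
    show "A \<noteq> {}" using Q(1) by (auto simp: A_def)
    show "A \<subseteq> \<P>" by (auto simp: A_def)
    show "leads X Y" if "X \<in> A" "Y \<in> A" for X Y
      using return[OF that(1)] that(2) by (auto simp: A_def)
    show "\<not> leads X Y" if "X \<in> A" "Y \<in> \<P> - A" for X Y
      using that rtranclp_trans[of step "Inr Q" "Inr X" "Inr Y"] by (auto simp: A_def)
  qed
  moreover have "Q \<in> A" using Q(1) by (simp add: A_def)
  ultimately show ?thesis using that Q(1) by blast
qed

text \<open>With equal energies \<open>Q\<close> would lead back to \<open>P\<close> and, the class
  being closed, \<open>P\<close> would belong to it.\<close>

lemma transient_leads:
  assumes P: "P \<in> \<P>" "P \<notin> \<Union>CL"
  obtains A Q where "A \<in> CL" "Q \<in> A" "leads P Q" "en Q < en P" "bar P = en P + \<Gamma>"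
proof -
  from leads_to_class[OF P(1)] obtain A Q where A: "A \<in> CL" "Q \<in> A" "leads P Q" .
  then have Q: "Q \<in> \<P>" "P \<noteq> Q" using class_subset P(2) by blast+
  have "en Q \<noteq> en P"
    using leads_energy(3)[OF P(1) Q(1) A(3) Q(2)] class_closed[OF A(1,2) P(1)] A(1) P(2) by blast
  then show ?thesis
    using that[OF A] leads_energy(1,2)[OF P(1) Q(1) A(3) Q(2)] by simp
qed

text \<open>
  A class cannot be left below or at the height \<open>en P + \<Gamma>\<close>: every state visited from the class
  leads back to it, so the heights along these trajectories are constant, and then the region they
  cover is surrounded by higher points.
\<close>

lemma class_separated:
  assumes A: "A \<in> CL" "P \<in> A" and Q: "Q \<in> \<P>" "Q \<notin> A" and xy: "x \<in> P" "y \<in> Q"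
  shows "en P + \<Gamma> < \<Phi> x y"
proof (cases "bar P = en P + \<Gamma>")
  case False
  have P: "P \<in> \<P>" "P \<noteq> Q" using class_subset A Q by blast+
  \<comment> \<open>A plateau deeper than the threshold is already separated by its own
    barrier.\<close>
  then have "en P + \<Gamma> < bar P" using False Gam_star_le[OF P(1)] by simp
  also have "\<dots> \<le> \<Phi> x y" by (rule barrier_le[OF P(1) Q(1) P(2) xy])
  finally show ?thesis .
next
  case True
  define L where "L = en P + \<Gamma>"
  define R where "R = {z. step\<^sup>*\<^sup>* (Inr P) z}"
  have P: "P \<in> \<P>" using class_subset A by blast
  have RJ: "R \<subseteq> JS" using steps_JS plateau_state(1)[OF P] by (auto simp: R_def)
  have deepR: "X \<in> A" if "X \<in> \<P>" "step\<^sup>*\<^sup>* z (Inr X)" "z \<in> R" for X z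
    using class_closed[OF A that(1)] rtranclp_trans[of step "Inr P" z "Inr X"] that(2,3)
    by (simp add: R_def)
  have barA: "L \<le> bar X" if "X \<in> A" for X
  proof -
    have "X \<in> \<P>" using class_subset A that by blast
    then show ?thesis
      using Gam_star_le[of X] class_energy[OF A that] by (simp add: L_def)
  qed
  have flat: "height z = L" if z: "z \<in> R" for z
  proof -
    obtain X where X: "X \<in> \<P>" "step\<^sup>*\<^sup>* z (Inr X)" using not_trapped RJ z by blast
    then have "L \<le> height z"
      using barA[OF deepR[OF X z]] steps_height[OF X(2)] plateau_state(2)[OF X(1)] by simp
    moreover have "height z \<le> L"
      using steps_height[of "Inr P" z] z plateau_state(2)[OF P] True by (simp add: R_def L_def)
    ultimately show ?thesis by simp
  qed
  have leave: "L < H v" if "E u v" "u \<in> \<Union>(points ` R)" "v \<notin> \<Union>(points ` R)" for u v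
  proof (rule flat_region_boundary[OF RJ _ flat _ that])
    show "z' \<in> R" if "z \<in> R" "step z z'" for z z'
      using that by (auto simp: R_def)
    fix C assume C: "C \<in> \<C>" "Inr (btm C) \<in> R"
    show "depth E H C \<le> \<Gamma>"
    proof (cases "C \<in> V ` \<P>")
      case False
      then show ?thesis using shallow[OF C(1)] by simp
    next
      case True
      then obtain X where X: "X \<in> \<P>" "C = V X" by blast
      then have XR: "Inr X \<in> R" using C(2) bottom_valley by simp
      \<comment> \<open>As a member of the class, \<open>X\<close> has the bottom energy of
        \<open>P\<close>; with exit level \<open>L\<close> its valley has depth exactly
        \<Gamma>.\<close>
      then have "X \<in> A" using deepR[OF X(1) _ XR] by simp
      moreover have "bar X = L" using flat[OF XR] plateau_state(2)[OF X(1)] by simp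
      ultimately show ?thesis
        using class_energy[OF A] X depth_valley by (simp add: L_def)
    qed
  qed
  have "Inr P \<in> R" by (simp add: R_def)
  then have "x \<in> \<Union>(points ` R)"
    using plateau_state(3)[OF P] subset_valley[OF P] xy(1) by blast
  \<comment> \<open>The only state of the chain that covers \<open>y\<close> is
    \<open>Inr Q\<close>, and a closed class does not reach \<open>Q\<close>.\<close>
  moreover have "y \<notin> \<Union>(points ` R)"
  proof
    assume "y \<in> \<Union>(points ` R)"
    then obtain z where z: "z \<in> R" "y \<in> points z" by blast
    have yV: "y \<in> V Q" using subset_valley[OF Q(1)] xy(2) by blast
    have "z \<in> JS" using RJ z(1) by blast
    then show False
    proof (cases rule: JS_cases)
      case (1 \<eta>)
      then show False using z(2) yV Delta_not_cycle valley_in[OF Q(1)] by auto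
    next
      case (2 C)
      then have "y \<in> C" using z(2) by simp
      then have "C = V Q" using cycles_disjoint[OF 2(2) valley_in[OF Q(1)]] yV by blast
      then have "z = Inr Q" using 2 bottom_valley[OF Q(1)] by simp
      then show False using deepR[OF Q(1) _ z(1)] Q(2) by simp
    qed
  qed
  ultimately obtain u v where "E u v" "u \<in> \<Union>(points ` R)" "v \<notin> \<Union>(points ` R)" "H v \<le> \<Phi> x y"
    using comm_height_crossing by metis
  then show ?thesis using leave by (force simp: L_def)
qed

lemma class_comm_height:
  assumes "P \<in> \<P>" "leads P Q" "Q \<in> \<P>" "x \<in> P" "y \<in> Q"
  shows "\<Phi> x y \<le> bar P"
proof -
  have "x \<in> V P" "y \<in> V Q" using assms subset_valley by blast+
  then show ?thesis
    using steps_comm_height[OF assms(2) plateau_state(1)[OF assms(1)], of x y]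
    by (simp only: plateau_state[OF assms(1)] plateau_state[OF assms(3)])
qed

text \<open>For \<open>\<eta>\<close> in a discarded plateau \<open>P\<close>, height
  \<open>bar P\<close> suffices to reach a lower recurrent plateau, and no other plateau is nearer
  than that. Otherwise the old witness is kept if its plateau is recurrent and moved on to a
  recurrent one below if it is transient.\<close>

lemma next_descent:
  assumes \<eta>: "\<eta> \<in> Obar" "\<eta> \<notin> \<Union>\<P>'"
  shows "\<exists>p\<in>\<Union>\<P>'. H p < H \<eta> \<and> (\<forall>\<xi>\<in>\<Union>\<P>'. H \<eta> \<le> H \<xi> \<longrightarrow> \<Phi> \<eta> p \<le> \<Phi> \<eta> \<xi>)"
proof (cases "\<eta> \<in> \<Union>\<P>")
  case True
  then obtain P where P: "P \<in> \<P>" "\<eta> \<in> P" by blast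
  then have "P \<notin> \<Union>CL" using \<eta>(2) by blast
  from transient_leads[OF P(1) this] obtain A Q where
    Q: "A \<in> CL" "Q \<in> A" "leads P Q" "en Q < en P" "bar P = en P + \<Gamma>" .
  have QP: "Q \<in> \<P>" using class_subset Q by blast
  obtain q where q: "q \<in> Q" using nonempty[OF QP] by blast
  have le: "\<Phi> \<eta> q \<le> bar P" using class_comm_height P Q(3) QP q by blast
  show ?thesis
  proof (intro bexI[of _ q] conjI ballI impI)
    show "H q < H \<eta>" using Q(4) energy_eq[OF P] energy_eq[OF QP q] by simp
    show "q \<in> \<Union>\<P>'" using Q(1,2) q by blast
    fix \<xi> assume "\<xi> \<in> \<Union>\<P>'"
    then obtain B X where B: "B \<in> CL" "X \<in> B" "\<xi> \<in> X" by blast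
    have "X \<in> \<P>" "P \<noteq> X" using B class_subset \<open>P \<notin> \<Union>CL\<close> by blast+
    then have "bar P \<le> \<Phi> \<eta> \<xi>" using barrier_le P B(3) by blast
    then show "\<Phi> \<eta> q \<le> \<Phi> \<eta> \<xi>" using le by simp
  qed
next
  case False
  from descent[OF \<eta>(1) this] obtain p where p: "p \<in> \<Union>\<P>" "H p < H \<eta>"
    "\<And>\<xi>. \<xi> \<in> \<Union>\<P> \<Longrightarrow> H \<eta> \<le> H \<xi> \<Longrightarrow> \<Phi> \<eta> p \<le> \<Phi> \<eta> \<xi>" by blast
  from p(1) obtain P where P: "P \<in> \<P>" "p \<in> P" by blast
  have sub: "\<Union>\<P>' \<subseteq> \<Union>\<P>" using class_subset by blast
  show ?thesis
  proof (cases "P \<in> \<Union>CL")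
    case True
    then have "p \<in> \<Union>\<P>'" using P(2) by blast
    then show ?thesis using p(2,3) sub by blast
  next
    case trans: False
    from transient_leads[OF P(1) this] obtain A Q where
      Q: "A \<in> CL" "Q \<in> A" "leads P Q" "en Q < en P" "bar P = en P + \<Gamma>" .
    have QP: "Q \<in> \<P>" using class_subset Q by blast
    obtain q where q: "q \<in> Q" using nonempty[OF QP] by blast
    have le: "\<Phi> p q \<le> H p + \<Gamma>"
      using class_comm_height[OF P(1) Q(3) QP P(2) q] Q(5) energy_eq[OF P] by simp
    show ?thesis
    proof (intro bexI[of _ q] conjI ballI impI)
      show "H q < H \<eta>" using Q(4) energy_eq[OF P] energy_eq[OF QP q] p(2) by simp
      show "q \<in> \<Union>\<P>'" using Q(1,2) q by blast
      fix \<xi> assume \<xi>: "\<xi> \<in> \<Union>\<P>'" "H \<eta> \<le> H \<xi>"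
      then obtain X where X: "X \<in> \<P>" "\<xi> \<in> X" using sub by blast
      \<comment> \<open>The energy of \<open>\<xi>\<close> exceeds that of \<open>P\<close>, so
        \<open>\<xi>\<close> lies in another plateau, whose barrier is above
        \<open>H p + \<Gamma>\<close>.\<close>
      have "P \<noteq> X" using const_energy[OF P(1,2), of \<xi>] X(2) \<xi>(2) p(2) by auto
      then have "bar X \<le> \<Phi> \<xi> p" using barrier_le X P by blast
      then have far: "H p + \<Gamma> \<le> \<Phi> \<xi> p"
        using Gam_star_le[OF X(1)] energy_eq[OF X] \<xi>(2) p(2) by simp
      have near: "\<Phi> \<eta> p \<le> \<Phi> \<eta> \<xi>" using p(3) \<xi> sub by blast
      \<comment> \<open>Going from \<open>\<xi>\<close> to \<open>p\<close> through
        \<open>\<eta>\<close> costs no more than \<Phi> \<open>\<eta> \<xi>\<close>; hence the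
        detour height \<open>H p + \<Gamma>\<close> is within this bound too.\<close>
      then have "\<Phi> \<xi> p \<le> \<Phi> \<eta> \<xi>"
        using comm_height_trans[of \<xi> \<eta> "\<Phi> \<eta> \<xi>" p] comm_height_sym[of \<xi> \<eta>] by simp
      then show "\<Phi> \<eta> q \<le> \<Phi> \<eta> \<xi>"
        using comm_height_trans[of \<eta> p "\<Phi> \<eta> \<xi>" q] near far le by simp
    qed
  qed
qed

theorem ground_state_recurrent:
  assumes "s \<in> ground_states H"
  shows "\<exists>P\<in>\<Union>CL. s \<in> P"
proof (rule ccontr)
  assume "\<not> ?thesis"
  then have "s \<notin> \<Union>\<P>'" by blast
  from next_descent[OF ground_states_Omega_bar[OF assms] this] obtain p where "H p < H s" by blast
  then show False using ground_states_le[OF assms, of p] by simp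
qed

lemma class_Union_inj:
  assumes "A \<in> CL" "B \<in> CL" "\<Union>A = \<Union>B"
  shows "A = B"
proof -
  obtain P where P: "P \<in> A" using class_nonempty assms(1) by blast
  then have "P \<in> \<P>" using class_subset assms(1) by blast
  then obtain p where p: "p \<in> P" using nonempty by blast
  then obtain Q where "Q \<in> B" "p \<in> Q" using P assms(3) by blast
  then have "Q = P" using disjoint[of Q P p] class_subset assms(2) \<open>P \<in> \<P>\<close> p by blast
  then show ?thesis using class_unique assms P \<open>Q \<in> B\<close> by blast
qed

lemma energy_class:
  assumes A: "A \<in> CL" "P \<in> A"
  shows "en (\<Union>A) = en P"
proof -
  have "P \<in> \<P>" using class_subset A by blast
  then obtain p where p: "p \<in> P" using nonempty by blast
  then have "\<Union>A \<noteq> {}" using A(2) by blast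
  from energy_attained[OF this] obtain x where x: "x \<in> \<Union>A" "en (\<Union>A) = H x" by (elim bexE)
  from x(1) obtain Q where Q: "Q \<in> A" "x \<in> Q" by blast
  then have "Q \<in> \<P>" using class_subset A(1) by blast
  then have "H x = en Q" using Q(2) by (rule energy_eq)
  then show ?thesis using x(2) class_energy[OF A Q(1)] by simp
qed

text \<open>The new barrier is attained between a member \<open>X\<close> of the class and a plateau
  outside it, to which \<open>class_separated\<close> applies. If \<open>X\<close> is not
  \<open>P\<close>, then \<open>P\<close> can be left, and \<open>bar P = en P + \<Gamma>\<close>
  reduces the second bound to the first.\<close>

lemma next_barrier:
  assumes A: "A \<in> CL" "P \<in> A" and other: "\<exists>B\<in>CL. B \<noteq> A"
  shows "en P + \<Gamma> < barrier \<P>' (\<Union>A)" and "bar P \<le> barrier \<P>' (\<Union>A)"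
proof -
  have PP: "P \<in> \<P>" using class_subset A by blast
  have neA: "\<Union>A \<noteq> {}" using nonempty[OF PP] A(2) by blast
  from other obtain B where B: "B \<in> CL" "B \<noteq> A" by blast
  then obtain Q where Q: "Q \<in> B" "Q \<in> \<P>" using class_nonempty class_subset by blast
  then obtain q where "q \<in> Q" using nonempty by blast
  moreover have "\<Union>B \<in> \<P>' - {\<Union>A}" using B class_Union_inj A(1) by blast
  ultimately have "\<Union>(\<P>' - {\<Union>A}) \<noteq> {}" using Q(1) by blast
  from comm_height_sets_attained[OF neA this] obtain x y where
    xy: "x \<in> \<Union>A" "y \<in> \<Union>(\<P>' - {\<Union>A})" "barrier \<P>' (\<Union>A) = \<Phi> x y"
    unfolding barrier_def by blast
  from xy(1) obtain X where X: "X \<in> A" "x \<in> X" by blast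
  from xy(2) obtain D Y where Y: "D \<in> CL" "D \<noteq> A" "Y \<in> D" "y \<in> Y" by blast
  have YP: "Y \<in> \<P>" "Y \<notin> A" using Y class_subset class_unique A(1) by blast+
  have XP: "X \<in> \<P>" using X class_subset A by blast
  have lt: "en X + \<Gamma> < \<Phi> x y" by (rule class_separated[OF A(1) X(1) YP X(2) Y(4)])
  then show "en P + \<Gamma> < barrier \<P>' (\<Union>A)" using xy(3) class_energy[OF A X(1)] by simp
  show "bar P \<le> barrier \<P>' (\<Union>A)"
  proof (cases "P = X")
    case True
    then have "bar P \<le> \<Phi> x y" using barrier_le[OF PP YP(1) _ _ Y(4)] X YP by blast
    then show ?thesis using xy(3) by simp
  next
    case False
    then show ?thesis
      using leads_energy(1)[OF PP XP class_leads[OF A X(1)]] lt xy(3) class_energy[OF A X(1)] by simp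
  qed
qed

end

section \<open>Propagation of the invariants\<close>

locale hierarchy_step = hierarchy_level +
  assumes ex_class: "CL \<noteq> {}" and ex_other_class: "A \<in> CL \<Longrightarrow> \<exists>B\<in>CL. B \<noteq> A"
begin

lemma plateaux_next: "plateaux E H \<P>'"
proof unfold_locales
  show "\<P>' \<noteq> {}" using ex_class by simp
  fix P' assume "P' \<in> \<P>'"
  then obtain A where A: "A \<in> CL" "P' = \<Union>A" by blast
  obtain P where P: "P \<in> A" using class_nonempty A(1) by blast
  then have "P \<in> \<P>" using class_subset A(1) by blast
  then show "P' \<noteq> {}" using nonempty P A(2) by blast
  from ex_other_class[OF A(1)] obtain B where B: "B \<in> CL" "B \<noteq> A" by blast
  then have "\<Union>B \<noteq> P'" using class_Union_inj[OF B(1) A(1)] A(2) by blast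
  then show "\<exists>Q\<in>\<P>'. Q \<noteq> P'" using B(1) by (intro bexI[of _ "\<Union>B"]) simp_all
  show "P' \<subseteq> Obar"
    unfolding A(2) using class_subset[OF A(1)] in_Omega_bar by (intro Union_least) blast
  fix x y assume "x \<in> P'" "y \<in> P'"
  then obtain X Y where XY: "X \<in> A" "x \<in> X" "Y \<in> A" "y \<in> Y" using A(2) by blast
  then have XYP: "X \<in> \<P>" "Y \<in> \<P>" using class_subset A(1) by blast+
  then show "H x = H y"
    using class_energy[OF A(1) XY(1,3)] energy_eq XY by simp
  note nb = next_barrier[OF A(1) XY(1) ex_other_class[OF A(1)]]
  \<comment> \<open>Inside one old plateau the old \<open>inner\<close> suffices. Two members of a
    class are joined at height \<open>en X + \<Gamma>\<close>, and the strict separation of the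
    class puts the new barrier above it.\<close>
  show "\<Phi> x y < barrier \<P>' P'"
  proof (cases "X = Y")
    case True
    then show ?thesis using inner[OF XYP(1) XY(2)] XY(4) nb(2) A(2) by force
  next
    case False
    have l: "leads X Y" using class_leads A(1) XY by blast
    have "\<Phi> x y \<le> bar X" using class_comm_height[OF XYP(1) l XYP(2) XY(2,4)] .
    also have "bar X = en X + \<Gamma>" using leads_energy(1)[OF XYP l False] .
    finally show ?thesis using nb(1) A(2) by simp
  qed
qed (rule next_descent)

interpretation nx: plateaux E H \<P>' by (rule plateaux_next)

abbreviation "\<C>' \<equiv> snd (next_level E H (\<P>, \<C>))"

lemma fst_next_level: "fst (next_level E H (\<P>, \<C>)) = \<P>'"
  by (simp add: next_level_def Let_def)

lemma valley_subset_next: 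
  assumes "A \<in> CL" "P \<in> A"
  shows "V P \<subseteq> nx.V (\<Union>A)"
proof
  fix x assume "x \<in> V P"
  moreover have P: "P \<in> \<P>" using class_subset assms by blast
  ultimately obtain p where p: "p \<in> P" "\<Phi> p x < bar P" using valley_iff by blast
  have "\<Phi> p x < nx.bar (\<Union>A)"
    using p(2) next_barrier(2)[OF assms ex_other_class[OF assms(1)]] by simp
  moreover have "\<Union>A \<in> \<P>'" "p \<in> \<Union>A" using assms p(1) by blast+
  ultimately show "x \<in> nx.V (\<Union>A)" using nx.valley_iff[of "\<Union>A" x] by blast
qed

text \<open>Valleys of recurrent plateaux are contained in the new valleys and so fail the
  disjointness test. The retained cycles can therefore be drawn from all of \<open>\<C>\<close>
  instead of the transient and shallow ones.\<close>

lemma next_cycles: "\<C>' = nx.V ` \<P>' \<union> {C \<in> \<C>. \<forall>P\<in>\<P>'. C \<inter> nx.V P = {}}"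
proof -
  let ?old = "V ` (\<P> - \<Union>CL) \<union> (\<C> - deep_cycles E H \<C> \<Gamma>)"
  have "{C \<in> ?old. \<forall>P\<in>\<P>'. C \<inter> nx.V P = {}} = {C \<in> \<C>. \<forall>P\<in>\<P>'. C \<inter> nx.V P = {}}"
  proof (intro Collect_cong rev_conj_cong refl)
    fix C
    assume disj: "\<forall>P\<in>\<P>'. C \<inter> nx.V P = {}"
    show "C \<in> ?old \<longleftrightarrow> C \<in> \<C>"
    proof
      assume "C \<in> ?old"
      then show "C \<in> \<C>" using valley_in by blast
    next
      assume C: "C \<in> \<C>"
      show "C \<in> ?old"
      proof (cases "C \<in> V ` \<P>")
        case True
        then obtain P where P: "P \<in> \<P>" "C = V P" by blast
        have "P \<notin> \<Union>CL"
        proof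
          assume "P \<in> \<Union>CL"
          then obtain A where A: "A \<in> CL" "P \<in> A" by blast
          have "C \<inter> nx.V (\<Union>A) = {}" using disj A(1) by blast
          then show False
            using valley_subset_next[OF A] P valley_nonempty[OF P(1)] by blast
        qed
        then show ?thesis using P by blast
      next
        case False
        then show ?thesis using C deep_iff[OF C] by (simp add: deep_cycles_def)
      qed
    qed
  qed
  then show ?thesis
    unfolding next_level_def shallow_cycles_def Let_def prod.case snd_conv by simp
qed

text \<open>Cycles that meet are nested. If a new valley lay inside \<open>C\<close>, so would an
  old valley of its class; disjointness makes that valley equal to \<open>C\<close>, which is then
  contained in the new one after all.\<close>

lemma old_cycle_cases:
  assumes "C \<in> \<C>"
  obtains "C \<in> \<C>'" "\<And>P. P \<in> \<P>' \<Longrightarrow> C \<inter> nx.V P = {}"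
  | P where "P \<in> \<P>'" "C \<subseteq> nx.V P"
proof (cases "\<forall>P\<in>\<P>'. C \<inter> nx.V P = {}")
  case True
  then show ?thesis using that(1) assms unfolding next_cycles by blast
next
  case False
  then obtain A where A: "A \<in> CL" "C \<inter> nx.V (\<Union>A) \<noteq> {}" by blast
  then have AP: "\<Union>A \<in> \<P>'" by blast
  from cycle_nested[OF cycles[OF assms] nx.cycle_valley[OF AP] A(2)]
  have "C \<subseteq> nx.V (\<Union>A)"
  proof
    assume sub: "nx.V (\<Union>A) \<subseteq> C"
    obtain P where P: "P \<in> A" using class_nonempty A(1) by blast
    then have PP: "P \<in> \<P>" using class_subset A(1) by blast
    have "V P \<subseteq> C" using valley_subset_next[OF A(1) P] sub by blast
    then have "V P = C"
      using cycles_disjoint[OF valley_in[OF PP] assms] valley_nonempty[OF PP] by blast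
    then show ?thesis using valley_subset_next[OF A(1) P] by simp
  qed
  then show ?thesis using that(2) AP by blast
qed

text \<open>Strictness is inherited from the separation of classes. It turns valleys of depth
  exactly \<Gamma>, those of transient plateaux, into shallow cycles of the next level.\<close>

lemma Gam_star_less: "\<Gamma> < nx.\<Gamma>"
proof -
  obtain A where A: "A \<in> CL" "nx.\<Gamma> = nx.bar (\<Union>A) - en (\<Union>A)"
    using nx.Gam_star_attained by blast
  obtain P where P: "P \<in> A" using class_nonempty A(1) by blast
  show ?thesis
    using A(2) next_barrier(1)[OF A(1) P ex_other_class[OF A(1)]] energy_class[OF A(1) P] by simp
qed

lemma next_cycle_cases:
  assumes "C \<in> \<C>'"
  obtains P where "P \<in> \<P>'" "C = nx.V P" | "C \<in> \<C>" "\<And>P. P \<in> \<P>' \<Longrightarrow> C \<inter> nx.V P = {}"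
  using assms unfolding next_cycles by blast

lemma next_valley_in: "P \<in> \<P>' \<Longrightarrow> nx.V P \<in> \<C>'"
  unfolding next_cycles by blast

lemma cycle_family_next: "cycle_family E H \<C>'"
proof unfold_locales
  fix C assume C: "C \<in> \<C>'"
  show "cycle C" using C
    by (cases rule: next_cycle_cases) (auto simp: nx.cycle_valley cycles)
  show "C \<subseteq> Obar" using C
    by (cases rule: next_cycle_cases) (auto simp: nx.valley_subset_Omega_bar cycles_in_Omega_bar)
  show "bd C \<noteq> {}" using C
  proof (cases rule: next_cycle_cases)
    case (1 P)
    then show ?thesis using nx.valley_exit[of P] by blast
  qed (simp add: boundary_nonempty)
  show "en (bd C) \<le> \<Phi>bar" using C
    by (cases rule: next_cycle_cases)
      (auto simp: nx.energy_boundary_valley nx.barrier_le_Phi_bar exit_le)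
  fix D assume D: "D \<in> \<C>'" "C \<noteq> D"
  show "C \<inter> D = {}" using C
  proof (cases rule: next_cycle_cases)
    case C: (1 P)
    show ?thesis using D(1)
    proof (cases rule: next_cycle_cases)
      case (1 Q)
      then show ?thesis using C D(2) nx.valleys_disjoint by metis
    next
      case 2
      then show ?thesis using C by blast
    qed
  next
    case C: 2
    show ?thesis using D(1)
      by (cases rule: next_cycle_cases) (use C D(2) cycles_disjoint in auto)
  qed
qed

interpretation nc: cycle_family E H \<C>' "nx.\<Gamma>" by (rule cycle_family_next)

lemma Delta_next: "nc.\<Delta> = \<Delta> - \<Union>(nx.V ` \<P>')"
proof -
  have "\<Union>\<C>' = \<Union>\<C> \<union> \<Union>(nx.V ` \<P>')"
  proof
    show "\<Union>\<C>' \<subseteq> \<Union>\<C> \<union> \<Union>(nx.V ` \<P>')" unfolding next_cycles by blast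
    have "C \<subseteq> \<Union>\<C>'" if "C \<in> \<C>" for C
      using that by (cases rule: old_cycle_cases) (use next_valley_in in blast)+
    then show "\<Union>\<C> \<union> \<Union>(nx.V ` \<P>') \<subseteq> \<Union>\<C>'" using next_valley_in by blast
  qed
  then show ?thesis by (auto simp: Delta_def)
qed

lemma enter_next:
  assumes "\<eta> \<in> nc.\<Delta>" "P \<in> \<P>'" "E \<eta> v" "v \<in> nx.V P"
  shows "nc.step (Inl \<eta>) (Inr P)"
proof -
  have "\<eta> \<notin> nx.V P" using assms(1,2) Delta_next by blast
  then have "\<eta> \<in> bd (nx.V P)" using assms(3,4) by (auto simp: boundary_iff)
  then show ?thesis
    using nc.step_Inl_Inr[OF next_valley_in[OF assms(2)]] assms(1) nx.bottom_valley[OF assms(2)] by simp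
qed

text \<open>
  A trajectory of the old chain is followed until it first enters one of the new valleys.
\<close>

lemma next_not_trapped_aux:
  assumes "step\<^sup>*\<^sup>* x (Inr P)" "P \<in> \<Union>CL" "x \<in> nc.JS"
  shows "\<exists>P\<in>\<P>'. nc.step\<^sup>*\<^sup>* x (Inr P)"
  using assms(1,3)
proof (induction rule: converse_rtranclp_induct)
  case base
  from assms(2) obtain A where A: "A \<in> CL" "P \<in> A" by blast
  have PP: "P \<in> \<P>" using A class_subset by blast
  have AP: "\<Union>A \<in> \<P>'" using A(1) by blast
  from base show ?case
  proof (cases rule: nc.JS_cases)
    case (2 C)
    have "P \<subseteq> C" using 2 bottom_subset[of C] by simp
    moreover have "P \<subseteq> nx.V (\<Union>A)" using nx.subset_valley[OF AP] A(2) by blast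
    \<comment> \<open>\<open>C\<close> contains \<open>P\<close> and thus meets the new valley of
      the class of \<open>P\<close>; members of the new family that meet are equal. Hence
      \<open>P\<close> is the union of its class.\<close>
    ultimately have "C = nx.V (\<Union>A)"
      using nc.cycles_disjoint[OF 2(2) next_valley_in[OF AP]] nonempty[OF PP] by blast
    then have "Inr P = Inr (\<Union>A)" using 2 nx.bottom_valley[OF AP] by simp
    then show ?thesis using AP by auto
  qed simp
next
  case (step x y)
  show ?case
  proof (cases "\<exists>P\<in>\<P>'. x = Inr P")
    case True
    then show ?thesis by blast
  next
    case xnew: False
    have cont: ?thesis if "nc.step x y"
      using that step.IH nc.step_JS(2)[OF that] by (meson converse_rtranclp_into_rtranclp)
    have stop: ?thesis if "P \<in> \<P>'" "nc.step x (Inr P)" for P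
      using that by blast
    show ?thesis using step(1)
    proof (cases rule: step_cases)
      case (flat \<eta> \<xi>)
      have \<eta>: "\<eta> \<in> nc.\<Delta>" using step.prems flat(1) by simp
      show ?thesis
      proof (cases "\<xi> \<in> nc.\<Delta>")
        case True
        then have "nc.step x y" using flat \<eta> by (simp add: nc.step_Inl_Inl)
        then show ?thesis by (rule cont)
      next
        case False
        then obtain P where P: "P \<in> \<P>'" "\<xi> \<in> nx.V P" using flat(4) Delta_next by blast
        then have "nc.step x (Inr P)" using enter_next[OF \<eta> P(1) flat(5)] flat(1) by simp
        then show ?thesis using stop P(1) by blast
      qed
    next
      case (enter \<eta> C)
      have \<eta>: "\<eta> \<in> nc.\<Delta>" using step.prems enter(1) by simp
      from enter(3) show ?thesis
      proof (cases rule: old_cycle_cases)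
        case 1
        then have "nc.step x y" using enter \<eta> by (simp add: nc.step_Inl_Inr)
        then show ?thesis by (rule cont)
      next
        case (2 P)
        from enter(5) obtain c where "c \<in> C" "E \<eta> c" by (auto simp: boundary_iff)
        then have "nc.step x (Inr P)" using enter_next[OF \<eta> 2(1), of c] 2(2) enter(1) by blast
        then show ?thesis using stop 2(1) by blast
      qed
    next
      case (exit \<eta> C)
      from step.prems obtain D where D: "D \<in> \<C>'" "btm D = btm C"
        using exit(1) by (cases rule: nc.JS_cases) auto
      have disj: "C \<in> \<C>'" "\<And>P. P \<in> \<P>' \<Longrightarrow> C \<inter> nx.V P = {}"
      proof -
        \<comment> \<open>A new valley is excluded by \<open>xnew\<close>, so \<open>D\<close> is an
          old cycle and is determined by its bottom.\<close>
        from D(1) have "D = C"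
        proof (cases rule: next_cycle_cases)
          case (1 P)
          then show ?thesis using D(2) exit(1) xnew nx.bottom_valley(1) by auto
        next
          case 2
          then show ?thesis using bottom_inj exit(3) D(2) by blast
        qed
        from D(1) show "C \<in> \<C>'" using \<open>D = C\<close> by simp
        from D(1) show "C \<inter> nx.V P = {}" if "P \<in> \<P>'" for P
        proof (cases rule: next_cycle_cases)
          case (1 Q)
          then show ?thesis using \<open>D = C\<close> exit(1) xnew nx.bottom_valley(1) by auto
        next
          case 2
          then show ?thesis using \<open>D = C\<close> that by blast
        qed
      qed
      \<comment> \<open>The exit point is adjacent to \<open>C\<close>, and disjoint cycles are
        never adjacent.\<close>
      have "\<eta> \<notin> nx.V P" if "P \<in> \<P>'" for P
      proof
        assume "\<eta> \<in> nx.V P"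
        moreover obtain c where "c \<in> C" "E c \<eta>" using exit(6) E_sym by (auto simp: boundary_iff)
        ultimately show False
          using cycles_not_adjacent[OF cycles[OF exit(3)] nx.cycle_valley[OF that] disj(2)[OF that]] by blast
      qed
      then have "\<eta> \<in> nc.\<Delta>" using exit(4) Delta_next by blast
      \<comment> \<open>The exit stays open: the depth of \<open>C\<close> is at most \<Gamma>,
        which is below the new threshold.\<close>
      then have "nc.step x y"
        using exit Gam_star_less disj(1) by (simp add: nc.step_Inr_Inl)
      then show ?thesis by (rule cont)
    qed
  qed
qed

lemma hierarchy_level_next: "hierarchy_level E H \<P>' \<C>'"
proof unfold_locales
  show "nx.V P \<in> \<C>'" if "P \<in> \<P>'" for P using that by (rule next_valley_in)
  show "depth E H C < nx.\<Gamma>" if "C \<in> \<C>'" "C \<notin> nx.V ` \<P>'" for C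
    using that(1)
  proof (cases rule: next_cycle_cases)
    case 2
    show ?thesis
    proof (cases "C \<in> V ` \<P>")
      case False
      then show ?thesis using shallow 2(1) Gam_star_less by fastforce
    next
      case True
      then obtain P where P: "P \<in> \<P>" "C = V P" by blast
      have "P \<notin> \<Union>CL"
      proof
        assume "P \<in> \<Union>CL"
        then obtain A where A: "A \<in> CL" "P \<in> A" by blast
        then have "C \<inter> nx.V (\<Union>A) = {}" using 2(2) by blast
        then show False using valley_subset_next[OF A] P valley_nonempty[OF P(1)] by blast
      qed
      \<comment> \<open>A retained old valley belongs to a transient plateau, so its depth is the
        old threshold.\<close>
      from transient_leads[OF P(1) this] have "bar P = en P + \<Gamma>" by blast
      then show ?thesis using depth_valley P Gam_star_less by simp
    qed
  qed (use that(2) in blast)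
  fix x assume x: "x \<in> nc.JS"
  show "\<exists>P\<in>\<P>'. nc.step\<^sup>*\<^sup>* x (Inr P)"
  proof (cases "x \<in> JS")
    case True
    then obtain P where P: "P \<in> \<P>" "step\<^sup>*\<^sup>* x (Inr P)" using not_trapped by blast
    obtain A Q where Q: "A \<in> CL" "Q \<in> A" "leads P Q" by (rule leads_to_class[OF P(1)])
    have "step\<^sup>*\<^sup>* x (Inr Q)" using P(2) Q(3) by simp
    then show ?thesis using next_not_trapped_aux[OF _ _ x] Q by blast
  next
    case False
    from x show ?thesis
    proof (cases rule: nc.JS_cases)
      case (1 \<eta>)
      then show ?thesis using False Delta_next by simp
    next
      case (2 C)
      from 2(2) show ?thesis
      proof (cases rule: next_cycle_cases)
        case (1 P)
        then show ?thesis using 2(1) nx.bottom_valley by auto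
      next
        case 3: 2
        then show ?thesis using False 2(1) Inr_JS by blast
      qed
    qed
  qed
qed

end

section \<open>Stable plateaux and the first level\<close>

context landscape
begin

lemma stable_plateau_energy:
  assumes "stable_plateau E H P" "x \<in> P"
  shows "H x = en P"
proof -
  from assms have "P \<noteq> {}" by blast
  from energy_attained[OF this] obtain y where y: "y \<in> P" "en P = H y" by (elim bexE)
  have "H x = H y" using assms y(1) unfolding stable_plateau_def by blast
  then show ?thesis using y(2) by simp
qed

lemma stable_plateau_comm_height:
  assumes P: "stable_plateau E H P" and "x \<in> P" "y \<in> P"
  shows "\<Phi> x y \<le> en P"
proof -
  obtain p where p: "is_path E x y p" "set p \<subseteq> P"
    using assms unfolding stable_plateau_def connected_in_graph_def by blast
  moreover have "P \<subseteq> {z. H z \<le> en P}" using stable_plateau_energy[OF P] by auto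
  ultimately show ?thesis unfolding comm_height_le_iff_path by blast
qed

lemma stable_plateau_exit:
  assumes P: "stable_plateau E H P" and "x \<in> P" "y \<notin> P"
  shows "en P < \<Phi> x y"
proof -
  from comm_height_crossing[OF assms(2,3)] obtain u v where
    uv: "E u v" "u \<in> P" "v \<notin> P" "H v \<le> \<Phi> x y" by metis
  then have "v \<in> bd P" by (blast intro: boundaryI)
  then have "en P < H v" using P by (simp add: stable_plateau_def)
  then show ?thesis using uv(4) by simp
qed

lemma stable_plateaux_disjoint:
  assumes "stable_plateau E H P" "stable_plateau E H Q" "x \<in> P" "x \<in> Q"
  shows "P = Q"
proof -
  have "Y \<subseteq> X" if X: "stable_plateau E H X" "x \<in> X" and Y: "stable_plateau E H Y" "x \<in> Y" for X Y
  proof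
    fix y assume y: "y \<in> Y"
    show "y \<in> X"
    proof (rule ccontr)
      assume "y \<notin> X"
      then have "en X < \<Phi> x y" by (rule stable_plateau_exit[OF X])
      also have "\<Phi> x y \<le> en Y" by (rule stable_plateau_comm_height[OF Y y])
      finally show False using stable_plateau_energy[OF X] stable_plateau_energy[OF Y] by simp
    qed
  qed
  then show ?thesis using assms by blast
qed

text \<open>The set is the component of \<open>m\<close> in the sublevel set at \<open>H m\<close>.
  The hypothesis keeps it from going below \<open>H m\<close>, so the energy is constant on it, and
  its neighbours must be higher.\<close>

lemma stable_plateau_of_local_min:
  assumes "\<And>z. \<Phi> m z \<le> H m \<Longrightarrow> H m \<le> H z"
  shows "stable_plateau E H {z. \<Phi> m z \<le> H m}"
proof -
  let ?Q = "{z. \<Phi> m z \<le> H m}"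
  have H: "H z = H m" if "z \<in> ?Q" for z
    using assms[of z] that comm_height_ge_right[of z m] by simp
  have m: "m \<in> ?Q" by simp
  from energy_attained[of ?Q] m obtain z where "z \<in> ?Q" "en ?Q = H z" by blast
  then have en: "en ?Q = H m" using H by metis
  show ?thesis
    unfolding stable_plateau_def connected_in_graph_def
  proof (intro conjI ballI)
    show "?Q \<noteq> {}" using m by blast
    show "H x = H y" if "x \<in> ?Q" "y \<in> ?Q" for x y using H that by metis
    fix x y assume x: "x \<in> ?Q" and y: "y \<in> ?Q"
    then have xy: "\<Phi> x y \<le> H m" using comm_height_trans[of x m] comm_height_sym[of x m] by simp
    then have *: "(\<lambda>u v. E u v \<and> H u \<le> H m \<and> H v \<le> H m)\<^sup>*\<^sup>* x y"
      by (simp add: comm_height_le_iff)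
    have "(\<lambda>u v. E u v \<and> u \<in> ?Q \<and> v \<in> ?Q)\<^sup>*\<^sup>* x y"
      using *
    proof (induction rule: rtranclp_induct)
      case (step u v)
      have "u \<in> ?Q"
        using step.hyps(1) x comm_height_trans[of m x "H m" u] H[OF x] by (simp add: comm_height_le_iff)
      moreover have "\<Phi> u v \<le> H m" using step.hyps(2) by (intro comm_height_edge) auto
      ultimately have "v \<in> ?Q" using comm_height_trans by blast
      then have "E u v \<and> u \<in> ?Q \<and> v \<in> ?Q" using step.hyps(2) \<open>u \<in> ?Q\<close> by blast
      with step.IH show ?case by (rule rtranclp.rtrancl_into_rtrancl)
    qed simp
    then show "\<exists>p. is_path E x y p \<and> set p \<subseteq> ?Q"
      unfolding ex_path_iff_rtranclp using x by blast
  next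
    fix z assume z: "z \<in> bd ?Q"
    then obtain w where w: "w \<in> ?Q" "E z w" "z \<notin> ?Q" by (auto simp: boundary_iff)
    have "\<not> H z \<le> H m"
    proof
      assume "H z \<le> H m"
      then have "\<Phi> w z \<le> H m" using H[OF w(1)] E_sym[OF w(2)] by (intro comm_height_edge) auto
      then show False using w comm_height_trans by blast
    qed
    then show "en ?Q < H z" using en by simp
  qed
qed

text \<open>Minimise the energy over what \<open>\<eta>\<close> reaches without climbing and take
  the component of a minimiser. The last alternative occurs when \<open>\<eta>\<close> is itself a
  minimiser.\<close>

lemma ex_stable_plateau_below:
  assumes "\<eta> \<in> Obar"
  obtains Q q where "stable_plateau E H Q" "Q \<subseteq> Obar" "q \<in> Q" "\<Phi> \<eta> q \<le> H \<eta>" "H q < H \<eta> \<or> \<eta> \<in> Q"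
proof -
  let ?D = "{z. \<Phi> \<eta> z \<le> H \<eta>}"
  have "\<eta> \<in> ?D" by simp
  then have "?D \<noteq> {}" by blast
  then obtain m where m: "m \<in> ?D" "en ?D = H m" using energy_attained[of ?D] by blast
  then have \<eta>m: "\<Phi> \<eta> m \<le> H \<eta>" "H m \<le> H \<eta>" using comm_height_ge_right[of m \<eta>] by auto
  let ?Q = "{z. \<Phi> m z \<le> H m}"
  have sub: "?Q \<subseteq> ?D" using comm_height_trans[of \<eta> m "H \<eta>"] \<eta>m by force
  have stable: "stable_plateau E H ?Q"
  proof (rule stable_plateau_of_local_min)
    fix z assume "\<Phi> m z \<le> H m"
    then have "z \<in> ?D" using sub by blast
    then show "H m \<le> H z" using energy_le[of z ?D] m(2) by simp
  qed
  have inO: "?Q \<subseteq> Obar"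
  proof
    fix z assume "z \<in> ?Q"
    then have "\<Phi> \<eta> z \<le> \<Phi>bar" using sub Omega_bar_energy[OF assms] by force
    then show "z \<in> Obar" by (rule Omega_bar_closed[OF assms])
  qed
  have "H m < H \<eta> \<or> \<eta> \<in> ?Q" using \<eta>m comm_height_sym[of m \<eta>] by auto
  then show ?thesis using that[OF stable inO _ \<eta>m(1)] by simp
qed

abbreviation "stable_plateaux \<equiv> {P. stable_plateau E H P \<and> P \<subseteq> Obar}"

lemma plateaux_initial:
  assumes two: "2 \<le> card stable_plateaux"
  shows "plateaux E H stable_plateaux"
proof unfold_locales
  obtain X Y where XY: "X \<in> stable_plateaux" "Y \<in> stable_plateaux" "X \<noteq> Y"
    using two card_le_Suc0_iff_eq[of stable_plateaux] by fastforce
  then show "stable_plateaux \<noteq> {}" by blast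
  fix P assume P: "P \<in> stable_plateaux"
  then have sP: "stable_plateau E H P" by simp
  show "P \<subseteq> Obar" using P by simp
  show neP: "P \<noteq> {}" using sP by (simp add: stable_plateau_def)
  show "\<exists>Q\<in>stable_plateaux. Q \<noteq> P" using XY by metis
  then obtain Q where Q: "Q \<in> stable_plateaux" "Q \<noteq> P" by blast
  fix x y assume xy: "x \<in> P" "y \<in> P"
  show "H x = H y" using stable_plateau_energy[OF sP] xy by simp
  have "\<Union>(stable_plateaux - {P}) \<noteq> {}"
  proof -
    have "Q \<noteq> {}" using Q by (simp add: stable_plateau_def)
    moreover have "Q \<subseteq> \<Union>(stable_plateaux - {P})" using Q by blast
    ultimately show ?thesis by blast
  qed
  from comm_height_sets_attained[OF neP this] obtain p r where
    pr: "p \<in> P" "r \<in> \<Union>(stable_plateaux - {P})" "barrier stable_plateaux P = \<Phi> p r"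
    unfolding barrier_def by (elim bexE)
  then obtain R where R: "stable_plateau E H R" "R \<noteq> P" "r \<in> R" by blast
  then have "r \<notin> P" using stable_plateaux_disjoint[OF R(1) sP R(3)] by blast
  then have "en P < \<Phi> p r" by (rule stable_plateau_exit[OF sP pr(1)])
  then show "\<Phi> x y < barrier stable_plateaux P"
    using stable_plateau_comm_height[OF sP xy] pr(3) by simp
next
  fix \<eta> assume \<eta>: "\<eta> \<in> Obar" "\<eta> \<notin> \<Union>stable_plateaux"
  obtain Q q where Q: "stable_plateau E H Q" "Q \<subseteq> Obar" "q \<in> Q" "\<Phi> \<eta> q \<le> H \<eta>"
    "H q < H \<eta> \<or> \<eta> \<in> Q"
    by (rule ex_stable_plateau_below[OF \<eta>(1)])
  then have "q \<in> \<Union>stable_plateaux" "H q < H \<eta>" using \<eta>(2) by blast+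
  \<comment> \<open>At the first level the comparison is immediate: no point is at communication
    height less than \<open>H \<eta>\<close> from \<open>\<eta>\<close>.\<close>
  moreover have "\<Phi> \<eta> q \<le> \<Phi> \<eta> \<xi>" for \<xi> using Q(4) comm_height_ge_left[of \<eta> \<xi>] by simp
  ultimately show "\<exists>p\<in>\<Union>stable_plateaux. H p < H \<eta> \<and>
      (\<forall>\<xi>\<in>\<Union>stable_plateaux. H \<eta> \<le> H \<xi> \<longrightarrow> \<Phi> \<eta> p \<le> \<Phi> \<eta> \<xi>)" by blast
qed

text \<open>The substance is \<open>not_trapped\<close>. A start that reaches no plateau visits only
  configurations. From a visited one of least height the chain covers a flat closed region, which is
  surrounded by higher points; but from every point of \<open>Obar\<close> a stable plateau is
  reached without climbing.\<close>

lemma hierarchy_level_initial: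
  assumes two: "2 \<le> card stable_plateaux"
  shows "hierarchy_level E H stable_plateaux (valley E H stable_plateaux ` stable_plateaux)"
proof -
  let ?P = stable_plateaux
  interpret pl: plateaux E H ?P by (rule plateaux_initial[OF two])
  let ?C = "pl.V ` ?P"
  interpret cf: cycle_family E H ?C pl.\<Gamma>
  proof unfold_locales
    fix C assume "C \<in> ?C"
    then obtain P where P: "P \<in> ?P" "C = pl.V P" by blast
    show "cycle C" using P pl.cycle_valley by blast
    show "C \<subseteq> Obar" using P pl.valley_subset_Omega_bar by blast
    show "bd C \<noteq> {}" using P pl.valley_exit by blast
    show "en (bd C) \<le> \<Phi>bar"
      unfolding P(2) pl.energy_boundary_valley[OF P(1)] by (rule pl.barrier_le_Phi_bar[OF P(1)])
    fix D assume "D \<in> ?C" "C \<noteq> D"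
    then obtain Q where Q: "Q \<in> ?P" "D = pl.V Q" "P \<noteq> Q" using P(2) by blast
    then show "C \<inter> D = {}" using P pl.valleys_disjoint by blast
  qed
  show ?thesis
  proof unfold_locales
    show "pl.V P \<in> ?C" if "P \<in> ?P" for P using that by blast
    show "depth E H C < pl.\<Gamma>" if "C \<in> ?C" "C \<notin> ?C" for C using that by blast
    fix x assume x: "x \<in> cf.JS"
    show "\<exists>P\<in>?P. cf.step\<^sup>*\<^sup>* x (Inr P)"
    proof (rule ccontr)
      assume neg: "\<not> ?thesis"
      have Inl: "\<exists>\<eta>\<in>cf.\<Delta>. z = Inl \<eta>" if z: "cf.step\<^sup>*\<^sup>* x z" for z
        using cf.steps_JS[OF z x]
      proof (cases rule: cf.JS_cases)
        case (2 C)
        then obtain P where P: "P \<in> ?P" "C = pl.V P" by blast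
        then have "z = Inr P" using 2(1) pl.bottom_valley(1)[OF P(1)] by simp
        then show ?thesis using neg P(1) z by blast
      qed blast
      define R where "R = {z. cf.step\<^sup>*\<^sup>* x z}"
      have "R \<noteq> {}" by (auto simp: R_def)
      then have "arg_min_on cf.height R \<in> R"
        and min: "\<And>z. z \<in> R \<Longrightarrow> cf.height (arg_min_on cf.height R) \<le> cf.height z"
        using arg_min_if_finite[of R cf.height] by (auto intro: arg_min_least)
      then obtain y where y: "cf.step\<^sup>*\<^sup>* x y" "\<And>z. cf.step\<^sup>*\<^sup>* x z \<Longrightarrow> cf.height y \<le> cf.height z"
        unfolding R_def by blast
      obtain \<zeta> where \<zeta>: "\<zeta> \<in> cf.\<Delta>" "y = Inl \<zeta>" using Inl[OF y(1)] by blast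
      define S where "S = {z. cf.step\<^sup>*\<^sup>* y z}"
      have S: "cf.step\<^sup>*\<^sup>* x z" if "z \<in> S" for z using y(1) that by (simp add: S_def)
      obtain Q q where Q: "stable_plateau E H Q" "Q \<subseteq> Obar" "q \<in> Q" "\<Phi> \<zeta> q \<le> H \<zeta>"
        by (rule ex_stable_plateau_below[OF cf.Delta_Omega_bar[OF \<zeta>(1)]])
      then have QP: "Q \<in> ?P" by blast
      have \<zeta>S: "\<zeta> \<in> \<Union>(cf.points ` S)" using \<zeta>(2) by (force simp: S_def)
      have qS: "q \<notin> \<Union>(cf.points ` S)"
      proof
        assume "q \<in> \<Union>(cf.points ` S)"
        then obtain z where z: "z \<in> S" "q \<in> cf.points z" by blast
        then obtain \<eta> where "\<eta> \<in> cf.\<Delta>" "z = Inl \<eta>" using Inl[OF S] by blast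
        then have "q \<in> cf.\<Delta>" using z(2) by simp
        moreover have "q \<in> pl.V Q" using pl.subset_valley[OF QP] Q(3) by blast
        ultimately show False using cf.Delta_not_cycle QP by blast
      qed
      obtain u v where uv: "E u v" "u \<in> \<Union>(cf.points ` S)" "v \<notin> \<Union>(cf.points ` S)"
        "H u \<le> \<Phi> \<zeta> q" "H v \<le> \<Phi> \<zeta> q"
        by (rule comm_height_crossing[OF \<zeta>S qS])
      have "H \<zeta> < H v"
      proof (rule cf.flat_region_boundary[OF _ _ _ _ uv(1-3)])
        show "S \<subseteq> cf.JS" using S x cf.steps_JS by blast
        show "z' \<in> S" if "z \<in> S" "cf.step z z'" for z z' using that by (auto simp: S_def)
        show "cf.height z = H \<zeta>" if z: "z \<in> S" for z
          using y(2)[OF S[OF z]] cf.steps_height[of y z] z \<zeta>(2) by (simp add: S_def)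
        show "depth E H C \<le> pl.\<Gamma>" if "Inr (cf.btm C) \<in> S" for C
          using Inl[OF S[OF that]] by blast
      qed
      then show False using uv(5) Q(4) by simp
    qed
  qed
qed

lemma hierarchy_level_level:
  assumes "1 \<le> h" "\<forall>k<h. 2 \<le> nu E H k"
  shows "hierarchy_level E H (fst (level E H h)) (snd (level E H h))"
  using assms
proof (induction h rule: nat_induct_at_least)
  case base
  then have "2 \<le> card stable_plateaux" by (simp add: nu_def initial_level_def Let_def)
  from hierarchy_level_initial[OF this] show ?case
    by (simp add: initial_level_def Let_def)
next
  case (Suc h)
  obtain \<P> \<C> where L: "level E H h = (\<P>, \<C>)" by (cases "level E H h")
  interpret hierarchy_level E H \<P> \<C> using Suc L by simp
  have "2 \<le> card CL" using Suc.prems[rule_format, of h] Suc.hyps L by (simp add: nu_def)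
  then obtain X Y where XY: "X \<in> CL" "Y \<in> CL" "X \<noteq> Y"
    using card_le_Suc0_iff_eq[of CL] by fastforce
  interpret hierarchy_step E H \<P> \<C>
    by unfold_locales (use XY in blast)+
  \<comment> \<open>The recursion for \<open>level\<close> matches two successors, since index 0 is
    a dummy.\<close>
  obtain k where "h = Suc k" using Suc.hyps by (cases h) auto
  then have "level E H (Suc h) = next_level E H (\<P>, \<C>)" using L by simp
  then show ?case using hierarchy_level_next fst_next_level by simp
qed

end

theorem theorem2p15:
  fixes E :: "'a :: finite \<Rightarrow> 'a \<Rightarrow> bool"
    and H :: "'a \<Rightarrow> real"
    and s :: 'a
    and h :: nat
  assumes "symp E" and "irreflp E" and "connected_in_graph E UNIV"
    and "nu E H 0 \<ge> 2"
    and "s \<in> ground_states H"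
    and "h \<ge> 1"
    and "\<forall>k<h. nu E H k \<ge> 2"
  shows "\<exists>P \<in> P_rec E H h. s \<in> P"
proof -
  interpret landscape E H by unfold_locales (rule assms)+
  interpret hierarchy_level E H "fst (level E H h)" "snd (level E H h)"
    by (rule hierarchy_level_level) (rule assms)+
  show ?thesis
    unfolding P_rec_def using ground_state_recurrent[OF assms(5)] by simp
qed

end
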